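(* Let $\mu$ be the probability Haar measure on $\mathbb{T}^1$ and let $(\mathbb{N}, * )$ be the multiplicative semigroup of positive integers with the natural ordering. Consider the expanding circle maps $T^k : \mathbb{T}^1 \to \mathbb{T}^1$, $\alpha \mapsto k\alpha$, where $k \in \mathbb{N}$. Then the dynamical system $(\mathbb{T}^1, \mu, (\mathbb{N}, * ), T)$ has the monotone shrinking target property (MSTP).
   Context: $\mathbb{T}^1 = \mathbb{R}/\mathbb{Z}$ with its usual quotient metric; $B(x,\rho)$ is the open ball ($B(x,0)=\emptyset$). A radius sequence is a function $r : \mathbb{N} \to \mathbb{R}_{\geq 0}$, $r_k := r(k)$. For a finite-measure-preserving system $(M,\mu,\mathbb{N},T)$ on a metric space $M$, with measure-preserving maps $T^k : M \to M$ $(k\in\mathbb{N})$ and preimages $T^{-k}A = (T^k)^{-1}(A)$, MSTP means: for every $x \in M$ and every radius sequence $r$ with $r_k \geq r_{k+1}$ for all $k \in \mathbb{N}$ (natural order) such that $\sum_{k \in \mathbb{N}} \mu(B(x, r_k)) = \infty$, one has $\mu(\limsup_k T^{-k}B(x, r_k)) = \mu(M)$, where $\limsup_k T^{-k}B(x,r_k)$ is the set of points lying in $T^{-k}B(x,r_k)$ for infinitely many $k$. *)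

theory Defs
  imports "HOL-Probability.Probability"
begin

section \<open>The circle group \<open>\<real>/\<int>\<close> with its quotient metric\<close>

quotient_type circle = real / "\<lambda>x y :: real. x - y \<in> \<int>"
  morphisms rep_circle circle_of
proof (rule equivpI)
  show "reflp (\<lambda>x y :: real. x - y \<in> \<int>)"
    by (simp add: reflp_def)
  show "symp (\<lambda>x y :: real. x - y \<in> \<int>)"
    by (metis (no_types, lifting) sympI Ints_minus minus_diff_eq)
  show "transp (\<lambda>x y :: real. x - y \<in> \<int>)"
    by (rule transpI) (metis Ints_add diff_add_cancel add_diff_eq)
qed

lemma circle_of_eq_iff: "circle_of x = circle_of y \<longleftrightarrow> x - y \<in> \<int>"
  by (rule circle.abs_eq_iff)

lemma circle_of_surj: obtains x where "a = circle_of x"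
  by (metis Quotient3_abs_rep Quotient3_circle)

instantiation circle :: ab_group_add
begin

lift_definition zero_circle :: circle is "0 :: real" .

lift_definition plus_circle :: "circle \<Rightarrow> circle \<Rightarrow> circle" is "(+)"
  by (metis Ints_add add_diff_add)

lift_definition uminus_circle :: "circle \<Rightarrow> circle" is "uminus"
  by (metis Ints_minus minus_diff_minus)

lift_definition minus_circle :: "circle \<Rightarrow> circle \<Rightarrow> circle" is "(-)"
proof -
  fix a b c d :: real
  assume "a - b \<in> \<int>" "c - d \<in> \<int>"
  then have "(a - b) - (c - d) \<in> \<int>" by (rule Ints_diff)
  then show "a - c - (b - d) \<in> \<int>" by (simp add: algebra_simps)
qed

instance
  by standard (transfer; simp)+

end

lemma circle_of_add: "circle_of (x + y) = circle_of x + circle_of y"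
  by (simp add: plus_circle.abs_eq)

instantiation circle :: metric_space
begin

definition dist_circle :: "circle \<Rightarrow> circle \<Rightarrow> real" where
  "dist a b = Inf {\<bar>x - y\<bar> | x y. circle_of x = a \<and> circle_of y = b}"

definition uniformity_circle :: "(circle \<times> circle) filter" where
  "uniformity_circle = (INF e\<in>{0<..}. principal {(x, y). dist x y < e})"

definition open_circle :: "circle set \<Rightarrow> bool" where
  "open_circle U \<longleftrightarrow> (\<forall>x\<in>U. eventually (\<lambda>(x', y). x' = x \<longrightarrow> y \<in> U) uniformity)"

lemma dist_circle_le: "dist (circle_of x) (circle_of y) \<le> \<bar>x - y\<bar>"
  unfolding dist_circle_def by (rule cInf_lower) (auto intro!: bdd_belowI[of _ 0])

lemma dist_circle_attained:
  obtains n :: int where "dist (circle_of x) (circle_of y) = \<bar>x - y - of_int n\<bar>"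
proof -
  let ?S = "{\<bar>x' - y'\<bar> | x' y'. circle_of x' = circle_of x \<and> circle_of y' = circle_of y}"
  let ?n = "round (x - y)"
  have "Inf ?S = \<bar>x - y - of_int ?n\<bar>"
  proof (rule cInf_eq_minimum)
    have "circle_of (x - of_int ?n) = circle_of x"
      by (simp add: circle_of_eq_iff)
    moreover have "\<bar>x - y - of_int ?n\<bar> = \<bar>(x - of_int ?n) - y\<bar>" by simp
    ultimately show "\<bar>x - y - of_int ?n\<bar> \<in> ?S" by blast
  next
    fix d assume "d \<in> ?S"
    then obtain x' y' where d: "d = \<bar>x' - y'\<bar>" and "x' - x \<in> \<int>" "y' - y \<in> \<int>"
      by (auto simp: circle_of_eq_iff)
    then obtain i j :: int where "x' = x + of_int i" "y' = y + of_int j"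
      by (metis Ints_cases add.commute diff_eq_eq)
    then have "d = \<bar>(x - y) - of_int (j - i)\<bar>" using d by simp
    then show "\<bar>x - y - of_int ?n\<bar> \<le> d" using round_diff_minimal[of "x - y" "j - i"] by simp
  qed
  then show thesis using that unfolding dist_circle_def by blast
qed

instance
proof
  fix a b c :: circle
  obtain x where a: "a = circle_of x" by (rule circle_of_surj)
  obtain y where b: "b = circle_of y" by (rule circle_of_surj)
  obtain z where c: "c = circle_of z" by (rule circle_of_surj)
  show "dist a b = 0 \<longleftrightarrow> a = b"
  proof
    assume "dist a b = 0"
    then obtain n :: int where "x - y = of_int n"
      by (metis a b abs_eq_0 dist_circle_attained eq_iff_diff_eq_0)
    then show "a = b" by (simp add: a b circle_of_eq_iff)
  next
    assume "a = b"
    moreover obtain n :: int where "dist a b = \<bar>x - y - of_int n\<bar>"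
      unfolding a b by (rule dist_circle_attained)
    ultimately show "dist a b = 0"
      using dist_circle_le[of x x] by (simp add: a)
  qed
  obtain m :: int where m: "dist a c = \<bar>x - z - of_int m\<bar>"
    unfolding a c by (rule dist_circle_attained)
  obtain n :: int where n: "dist b c = \<bar>y - z - of_int n\<bar>"
    unfolding b c by (rule dist_circle_attained)
  have "circle_of (x - of_int m) = a" "circle_of (y - of_int n) = b"
    by (simp_all add: a b circle_of_eq_iff)
  then have "dist a b = dist (circle_of (x - of_int m)) (circle_of (y - of_int n))"
    by (simp only:)
  also have "\<dots> \<le> \<bar>(x - of_int m) - (y - of_int n)\<bar>" by (rule dist_circle_le)
  also have "\<dots> \<le> dist a c + dist b c" unfolding m n by linarith
  finally show "dist a b \<le> dist a c + dist b c" .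
qed (simp_all add: uniformity_circle_def open_circle_def)

end

lemma continuous_on_circle_of: "continuous_on A circle_of"
  by (rule continuous_onI) (metis dist_circle_le dist_real_def le_less_trans less_imp_le)

lemma measurable_circle_of [measurable]: "circle_of \<in> borel_measurable borel"
  by (intro borel_measurable_continuous_onI continuous_on_circle_of)

instance circle :: topological_ab_group_add
proof
  have add_le: "dist (a + b) (c + d) \<le> dist a c + dist b d" for a b c d :: circle
  proof -
    obtain x y z w where eq: "a = circle_of x" "b = circle_of y" "c = circle_of z" "d = circle_of w"
      by (metis circle_of_surj)
    obtain m :: int where m: "dist a c = \<bar>x - z - of_int m\<bar>"
      unfolding eq by (rule dist_circle_attained)
    obtain n :: int where n: "dist b d = \<bar>y - w - of_int n\<bar>"
      unfolding eq by (rule dist_circle_attained)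
    have "dist (a + b) (c + d) = dist (circle_of (x + y - of_int (m + n))) (circle_of (z + w))"
      unfolding eq circle_of_add[symmetric]
      by (rule arg_cong2[where f = dist]) (simp_all only: circle_of_eq_iff, simp_all)
    also have "\<dots> \<le> \<bar>(x + y - of_int (m + n)) - (z + w)\<bar>" by (rule dist_circle_le)
    also have "\<dots> \<le> dist a c + dist b d" unfolding m n by simp
    finally show ?thesis .
  qed
  have minus_le: "dist (- a) (- b) \<le> dist a b" for a b :: circle
  proof -
    have "dist (- a) (- b) = dist (b + (- a - b)) (a + (- a - b))" by (simp add: algebra_simps)
    also have "\<dots> \<le> dist b a + 0" using add_le[of b "- a - b" a "- a - b"] by simp
    finally show ?thesis by (simp add: dist_commute)
  qed
  show "((\<lambda>x. fst x + snd x) \<longlongrightarrow> a + b) (nhds a \<times>\<^sub>F nhds b)" for a b :: circle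
  proof (rule tendstoI)
    fix e :: real assume "e > 0"
    then have "\<forall>\<^sub>F x in nhds a. dist x a < e / 2" "\<forall>\<^sub>F y in nhds b. dist y b < e / 2"
      by (metis eventually_nhds_metric half_gt_zero)+
    then have "\<forall>\<^sub>F p in nhds a \<times>\<^sub>F nhds b. dist (fst p) a < e / 2 \<and> dist (snd p) b < e / 2"
      unfolding eventually_prod_filter by (metis fst_conv snd_conv)
    then show "\<forall>\<^sub>F p in nhds a \<times>\<^sub>F nhds b. dist (fst p + snd p) (a + b) < e"
    proof (rule eventually_mono)
      fix p assume "dist (fst p) a < e / 2 \<and> dist (snd p) b < e / 2"
      then show "dist (fst p + snd p) (a + b) < e"
        using add_le[of "fst p" "snd p" a b] by linarith
    qed
  qed
  show "(uminus \<longlongrightarrow> - a) (nhds a)" for a :: circle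
  proof (rule tendstoI)
    fix e :: real assume "e > 0"
    then have "\<forall>\<^sub>F x in nhds a. dist x a < e" by (metis eventually_nhds_metric)
    then show "\<forall>\<^sub>F x in nhds a. dist (- x) (- a) < e"
      by (rule eventually_mono) (use minus_le le_less_trans in blast)
  qed
qed

lift_definition circle_scale :: "nat \<Rightarrow> circle \<Rightarrow> circle" is "\<lambda>k x. real k * x"
  by (metis Ints_mult Ints_of_nat right_diff_distrib)

text \<open>Agreement with iterated addition in the group.\<close>

lemma circle_scale_simps: "circle_scale 0 a = 0" "circle_scale (Suc k) a = a + circle_scale k a"
  by (transfer; simp add: algebra_simps)+

section \<open>Haar probability measure\<close>

text \<open>Regularity is not listed: every finite Borel measure on a compact metric space is regular.\<close>

definition haar_prob_measure :: "circle measure \<Rightarrow> bool" where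
  "haar_prob_measure \<mu> \<longleftrightarrow> prob_space \<mu> \<and> sets \<mu> = sets borel \<and>
     (\<forall>a. \<forall>A\<in>sets borel. emeasure \<mu> ((+) a ` A) = emeasure \<mu> A)"

text \<open>Existence, by transporting Lebesgue measure from \<open>[0, 1)\<close>.\<close>

lemma haar_prob_measure_exists: "\<exists>\<mu>. haar_prob_measure \<mu>"
proof -
  define L where "L = restrict_space lborel {0..<1::real}"
  define \<mu> where "\<mu> = distr L borel circle_of"
  have meas: "circle_of \<in> measurable L borel"
    unfolding L_def by (rule measurable_restrict_space1) (simp add: measurable_lborel1)
  have em: "emeasure \<mu> A = emeasure lborel (circle_of -` A \<inter> {0..<1})" if "A \<in> sets borel" for A
  proof -
    have "emeasure \<mu> A = emeasure L (circle_of -` A \<inter> {0..<1})"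
      unfolding \<mu>_def using emeasure_distr[OF meas that] by (simp add: L_def)
    also have "\<dots> = emeasure lborel (circle_of -` A \<inter> {0..<1})"
      unfolding L_def by (rule emeasure_restrict_space) auto
    finally show ?thesis .
  qed
  have shift: "emeasure lborel ((+) c -` X) = emeasure lborel X" if "X \<in> sets borel" for c and X :: "real set"
    using emeasure_distr[of "(+) c" lborel borel X] that by (simp add: lborel_distr_plus)
  have pre: "circle_of -` A \<in> sets borel" if "A \<in> sets borel" for A
    using measurable_sets[OF measurable_circle_of that] by simp
  have "emeasure \<mu> ((+) a ` A) = emeasure \<mu> A" if A: "A \<in> sets borel" for a A
  proof -
    obtain u where u: "a = circle_of u" by (rule circle_of_surj)
    define t where "t = frac u"
    have t: "a = circle_of t" "0 \<le> t" "t < 1"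
      by (simp_all add: u t_def circle_of_eq_iff frac_def frac_lt_1[unfolded frac_def])
    have img: "(+) a ` A = (+) (- a) -` A"
    proof (intro set_eqI iffI)
      show "x \<in> (+) (- a) -` A" if "x \<in> (+) a ` A" for x using that by auto
      show "x \<in> (+) a ` A" if "x \<in> (+) (- a) -` A" for x
        using that by (intro image_eqI[of _ _ "- a + x"]) simp_all
    qed
    have B: "(+) a ` A \<in> sets borel"
    proof -
      have "(+) (- a) \<in> borel_measurable borel"
        by (intro borel_measurable_continuous_onI continuous_intros)
      from measurable_sets[OF this A] show ?thesis by (simp add: img)
    qed
    define S S' where "S = circle_of -` A" and "S' = circle_of -` ((+) a ` A)"
    have S: "S \<in> sets borel" "S' \<in> sets borel" unfolding S_def S'_def using A B pre by auto
    have 1: "t + x \<in> S' \<longleftrightarrow> x \<in> S" for x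
      by (auto simp: S_def S'_def t(1) circle_of_add)
    have 2: "t - 1 + x \<in> S' \<longleftrightarrow> x \<in> S" for x
    proof -
      have "circle_of (t - 1 + x) = circle_of (t + x)" by (simp add: circle_of_eq_iff)
      then show ?thesis using 1[of x] by (simp add: S'_def)
    qed
    have "emeasure lborel (S' \<inter> {0..<1}) =
        emeasure lborel ((S' \<inter> {t..<1}) \<union> (S' \<inter> {0..<t}))"
      using t by (intro arg_cong[where f = "emeasure lborel"]) auto
    also have "\<dots> = emeasure lborel (S' \<inter> {t..<1}) + emeasure lborel (S' \<inter> {0..<t})"
      by (rule plus_emeasure[symmetric]) (use S in auto)
    also have "emeasure lborel (S' \<inter> {t..<1}) = emeasure lborel ((+) t -` (S' \<inter> {t..<1}))"
      by (rule shift[symmetric]) (use S in auto)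
    also have "(+) t -` (S' \<inter> {t..<1}) = S \<inter> {0..<1 - t}" using 1 by auto
    also have "emeasure lborel (S' \<inter> {0..<t}) = emeasure lborel ((+) (t - 1) -` (S' \<inter> {0..<t}))"
      by (rule shift[symmetric]) (use S in auto)
    also have "(+) (t - 1) -` (S' \<inter> {0..<t}) = S \<inter> {1 - t..<1}" using 2 by auto
    also have "emeasure lborel (S \<inter> {0..<1 - t}) + emeasure lborel (S \<inter> {1 - t..<1}) =
        emeasure lborel ((S \<inter> {0..<1 - t}) \<union> (S \<inter> {1 - t..<1}))"
      by (rule plus_emeasure) (use S in auto)
    also have "(S \<inter> {0..<1 - t}) \<union> (S \<inter> {1 - t..<1}) = S \<inter> {0..<1}" using t by auto
    finally show ?thesis unfolding em[OF A] em[OF B] S_def S'_def .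
  qed
  moreover have "prob_space \<mu>"
    by (rule prob_spaceI) (use em[of UNIV] in \<open>simp add: \<mu>_def\<close>)
  moreover have "sets \<mu> = sets borel" by (simp add: \<mu>_def)
  ultimately show ?thesis unfolding haar_prob_measure_def by blast
qed

section \<open>Measure-preserving systems and shrinking targets\<close>

text \<open>
  The acting semigroup is the multiplicative semigroup of positive integers. It is indexed by
  the type of natural numbers, and the value of \<open>T\<close> and of a radius sequence at \<open>0\<close> is irrelevant.
\<close>

definition fmp_system :: "'a::metric_space measure \<Rightarrow> (nat \<Rightarrow> 'a \<Rightarrow> 'a) \<Rightarrow> bool" where
  "fmp_system \<mu> T \<longleftrightarrow> finite_measure \<mu> \<and> sets \<mu> = sets borel \<and>
     (\<forall>j\<ge>1. \<forall>k\<ge>1. T (j * k) = T j \<circ> T k) \<and>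
     (\<forall>k\<ge>1. T k \<in> measurable \<mu> \<mu> \<and>
        (\<forall>A\<in>sets \<mu>. emeasure \<mu> (T k -` A) = emeasure \<mu> A))"

definition MSTP :: "'a::metric_space measure \<Rightarrow> (nat \<Rightarrow> 'a \<Rightarrow> 'a) \<Rightarrow> bool" where
  "MSTP \<mu> T \<longleftrightarrow>
     (\<forall>x r. (\<forall>k\<ge>1. 0 \<le> r k) \<and> (\<forall>k\<ge>1. r (k + 1) \<le> r k) \<and>
            (\<Sum>k. emeasure \<mu> (ball x (r (k + 1)))) = \<infinity> \<longrightarrow>
        emeasure \<mu> {y. infinite {k. 1 \<le> k \<and> y \<in> T k -` ball x (r k)}} = emeasure \<mu> (space \<mu>))"

end

theory Submission
  imports Defs
begin

text \<open>
  Haar measure on the circle is Lebesgue measure on a fundamental domain, so the shrinking target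
  property is an inhomogeneous Khintchine theorem: for a fixed real \<open>y\<close> and decreasing radii with
  divergent sum, almost every \<open>a\<close> in \<open>(0, 1)\<close> satisfies \<open>\<bar>k a - y - m\<bar> < r k\<close> for infinitely many \<open>k\<close>
  and suitable integers \<open>m\<close>.

  Fix an open set \<open>B\<close> in \<open>(0, 1)\<close>. By Dirichlet's theorem, most points of \<open>B\<close> have a rational
  approximation whose denominator is comparable to \<open>2^t\<close>, and hence lie within \<open>C / 4^t\<close> of a point
  \<open>(y + m) / k\<close> with \<open>k\<close> between \<open>2^t\<close> and \<open>2^(t+1)\<close>. A maximal separated set of such points is a
  well-spaced family in \<open>B\<close> at every large dyadic scale. Shrinking the balls of these families to
  radius at most \<open>r (2^(t+1)) / 2^(t+1)\<close> gives sets \<open>A t\<close> which are quasi-independent on \<open>B\<close> and, by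
  Cauchy condensation, have divergent total measure. The second moment method then shows that the
  approximable points fill a fixed proportion of \<open>B\<close>. As \<open>B\<close> is arbitrary and the proportion does not
  depend on it, outer regularity makes the complement null.
\<close>

section \<open>Second moments and thin sets\<close>

text \<open>
  With \<open>S\<close> the sum of the indicators, integrate \<open>2 c S - c\<^sup>2 S\<^sup>2 \<le> 1\<close> over the union; the best \<open>c\<close>
  gives the Cauchy--Schwarz bound.
\<close>

lemma measure_UN_ge_second_moment:
  fixes A :: "'i \<Rightarrow> 'a set" and c :: real
  assumes I: "finite I" and A: "\<And>i. i \<in> I \<Longrightarrow> A i \<in> fmeasurable M"
  shows "2 * c * (\<Sum>i\<in>I. measure M (A i)) - c\<^sup>2 * (\<Sum>i\<in>I. \<Sum>j\<in>I. measure M (A i \<inter> A j))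
    \<le> measure M (\<Union>i\<in>I. A i)"
proof -
  have AA: "A i \<inter> A j \<in> fmeasurable M" if "i \<in> I" "j \<in> I" for i j
    using A that by (auto intro: fmeasurable.Int)
  have UA: "(\<Union>i\<in>I. A i) \<in> fmeasurable M"
    using I A by (intro fmeasurable.finite_UN) auto
  have int: "integrable M (indicat_real X)" if "X \<in> fmeasurable M" for X
    using that by (simp add: integrable_indicator_iff fmeasurable_def)
  have val: "(\<integral>x. indicat_real X x \<partial>M) = measure M X" if "X \<in> fmeasurable M" for X
    using that by (simp add: fmeasurable_def)
  let ?S = "\<lambda>x. \<Sum>i\<in>I. indicat_real (A i) x"
  let ?R = "\<lambda>x. \<Sum>i\<in>I. \<Sum>j\<in>I. indicat_real (A i \<inter> A j) x"
  have R: "?R x = (?S x)\<^sup>2" for x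
    by (simp add: power2_eq_square sum_product indicator_inter_arith)
  have pt: "2 * c * ?S x - c\<^sup>2 * ?R x \<le> indicat_real (\<Union>i\<in>I. A i) x" for x
  proof (cases "x \<in> (\<Union>i\<in>I. A i)")
    case True
    have "0 \<le> (1 - c * ?S x)\<^sup>2" by simp
    then show ?thesis unfolding R using True by (simp add: power2_eq_square algebra_simps)
  next
    case False
    then have "?S x = 0" by (auto intro!: sum.neutral simp: indicator_def)
    then show ?thesis unfolding R by simp
  qed
  have "2 * c * (\<Sum>i\<in>I. measure M (A i)) - c\<^sup>2 * (\<Sum>i\<in>I. \<Sum>j\<in>I. measure M (A i \<inter> A j))
      = (\<integral>x. 2 * c * ?S x - c\<^sup>2 * ?R x \<partial>M)"
    using A AA by (subst Bochner_Integration.integral_diff)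
      (auto simp: int val intro!: Bochner_Integration.integrable_sum integrable_mult_right)
  also have "\<dots> \<le> (\<integral>x. indicat_real (\<Union>i\<in>I. A i) x \<partial>M)"
    using A AA UA pt by (intro integral_mono)
      (auto simp: int intro!: Bochner_Integration.integrable_diff Bochner_Integration.integrable_sum integrable_mult_right)
  also have "\<dots> = measure M (\<Union>i\<in>I. A i)" by (rule val[OF UA])
  finally show ?thesis .
qed

text \<open>A substitute for the Lebesgue density theorem: if \<open>E\<close> had positive measure,
  outer regularity would give an open \<open>V\<close> around it with excess below \<open>c\<close>
  times the measure of \<open>E\<close>, and \<open>V \<inter> U\<close> would violate
  \<open>thin\<close>.\<close>

lemma measure_zero_if_thin_in_open_sets:
  fixes E U :: "real set"
  assumes E: "E \<in> sets borel" "E \<subseteq> U" and U: "open U" "emeasure lborel U < \<infinity>" and c: "0 < c"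
    and thin: "\<And>B. open B \<Longrightarrow> B \<subseteq> U \<Longrightarrow> 0 < measure lborel B \<Longrightarrow>
       c * measure lborel B \<le> measure lborel (B - E)"
  shows "emeasure lborel E = 0"
proof (rule ccontr)
  assume ne: "emeasure lborel E \<noteq> 0"
  have fU: "U \<in> fmeasurable lborel" using U by (simp add: fmeasurable_def)
  have fE: "E \<in> fmeasurable lborel" using E fU by (intro fmeasurableI2[OF fU]) auto
  have pos: "measure lborel E > 0"
    using ne fE by (metis emeasure_eq_measure2 ennreal_0 zero_less_measure_iff)
  obtain V where V: "open V" "E \<subseteq> V" "emeasure lborel (V - E) < ennreal (c * measure lborel E)"
    by (rule outer_regular_lborel[OF E(1), of "c * measure lborel E"]) (use pos c in auto)
  define B where "B = V \<inter> U"
  have B: "open B" "B \<subseteq> U" "E \<subseteq> B" using V U E by (auto simp: B_def)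
  have fB: "B \<in> fmeasurable lborel" using B by (intro fmeasurableI2[OF fU]) auto
  have EB: "measure lborel E \<le> measure lborel B" using B fB E by (intro measure_mono_fmeasurable) auto
  have fBE: "B - E \<in> fmeasurable lborel" using fB fE by (rule fmeasurable.Diff)
  have "emeasure lborel (B - E) \<le> emeasure lborel (V - E)"
    using V E by (intro emeasure_mono) (auto simp: B_def)
  then have "ennreal (measure lborel (B - E)) < ennreal (c * measure lborel E)"
    using V(3) fBE by (simp add: emeasure_eq_measure2)
  then have "measure lborel (B - E) < c * measure lborel E"
    using pos c by (simp add: ennreal_less_iff)
  also have "\<dots> \<le> c * measure lborel B" using EB c by simp
  also have "\<dots> \<le> measure lborel (B - E)" using thin[of B] B EB pos by simp
  finally show False by simp
qed

lemma not_summable_sum_ge: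
  fixes f :: "nat \<Rightarrow> real"
  assumes f: "\<And>n. 0 \<le> f n" and ns: "\<not> summable f"
  shows "\<exists>N. M \<le> (\<Sum>n\<in>{K..<N}. f n)"
proof (rule ccontr)
  assume "\<not> ?thesis"
  then have *: "(\<Sum>n\<in>{K..<N}. f n) \<le> M" for N by (simp add: not_le less_imp_le)
  have "(\<Sum>n<N. f n) \<le> (\<Sum>n<K. f n) + M" for N
  proof -
    have "(\<Sum>n<N. f n) \<le> (\<Sum>n\<in>{..<K} \<union> {K..<N}. f n)" using f by (intro sum_mono2) auto
    also have "\<dots> = (\<Sum>n<K. f n) + (\<Sum>n\<in>{K..<N}. f n)" by (intro sum.union_disjoint) auto
    finally show ?thesis using *[of N] by simp
  qed
  then have "summable f" using f by (intro summableI_nonneg_bounded) auto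
  with ns show False by simp
qed

text \<open>A convergent truncated series has terms tending to 0, so the truncation is eventually
  inactive.\<close>

lemma not_summable_min:
  fixes f :: "nat \<Rightarrow> real"
  assumes f: "\<And>n. 0 \<le> f n" and ns: "\<not> summable f" and c: "0 < c"
  shows "\<not> summable (\<lambda>n. min c (f n))"
proof
  assume s: "summable (\<lambda>n. min c (f n))"
  then have "(\<lambda>n. min c (f n)) \<longlonglongrightarrow> 0" by (rule summable_LIMSEQ_zero)
  then have "\<forall>\<^sub>F n in sequentially. min c (f n) < c" using c by (rule order_tendstoD)
  then have "\<forall>\<^sub>F n in sequentially. min c (f n) = f n" by eventually_elim auto
  then have "summable f" using s summable_cong by fast
  with ns show False by simp
qed

section \<open>Inhomogeneous approximation at a dyadic scale\<close>

text \<open>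
  If \<open>a\<close> is close to \<open>p / q\<close>, then \<open>q\<close> consecutive multiples of \<open>a\<close> follow a translate of \<open>(1/q) \<int>\<close>
  modulo 1, so one of them is close to \<open>y\<close>.
\<close>

lemma exists_inhomogeneous_approximation:
  fixes a y :: real and p q :: int and N :: nat
  assumes "coprime p q" "0 < q" "q \<le> int N" "\<bar>of_int q * a - of_int p\<bar> < 1 / N"
  shows "\<exists>k\<in>{N..<2*N}. \<exists>m::int. \<bar>real k * a - y - of_int m\<bar> \<le> 1 / (2 * of_int q) + 1 / N"
proof -
  define z where "z = of_int q * (real N * a - y)"
  define n where "n = round z"
  have zn: "\<bar>z - of_int n\<bar> \<le> 1/2"
    using of_int_round_abs_le[of z] by (simp add: n_def abs_minus_commute)
  obtain u v where uv: "u * p + v * q = 1" using assms(1) bezout_int[of p q] by (metis coprime_imp_gcd_eq_1)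
  \<comment> \<open>\<open>u\<close> inverts \<open>p\<close> modulo \<open>q\<close>, so
    \<open>j * p\<close> is congruent to \<open>- n\<close>. Passing from \<open>N\<close> to
    \<open>N + j\<close> moves \<open>z\<close> by about \<open>j * p\<close>, which cancels
    \<open>n\<close> up to the multiple \<open>q * m\<close>.\<close>
  define j where "j = (- n * u) mod q"
  have j: "0 \<le> j" "j < q" using assms(2) by (auto simp: j_def)
  define d where "d = (- n * u) div q"
  define m where "m = n * v - d * p"
  have "j = - n * u - q * d" unfolding j_def d_def by (rule minus_mult_div_eq_mod[symmetric])
  then have "j * p = (- n * u - q * d) * p" by (rule arg_cong)
  also have "\<dots> = - n * (u * p) - q * d * p" by (simp add: algebra_simps)
  also have "u * p = 1 - v * q" using uv by (simp add: algebra_simps)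
  also have "- n * (1 - v * q) - q * d * p = - n + q * m"
    by (simp add: m_def algebra_simps)
  finally have m: "j * p = - n + q * m" .
  define k where "k = N + nat j"
  have k: "k \<in> {N..<2*N}" using j assms(3) by (auto simp: k_def)
  have rk: "real k = real N + of_int j" using j by (simp add: k_def)
  have q: "(0::real) < of_int q" using assms(2) by simp
  have mr: "of_int j * of_int p = - of_int n + of_int q * (of_int m :: real)"
    using m by (metis of_int_add of_int_minus of_int_mult)
  have "of_int q * (real k * a - y - of_int m) = z + of_int j * (of_int q * a) - of_int q * of_int m"
    by (simp add: rk z_def algebra_simps)
  also have "\<dots> = (z - of_int n) + of_int j * (of_int q * a - of_int p)"
    using mr by (simp add: algebra_simps)
  finally have "\<bar>of_int q * (real k * a - y - of_int m)\<bar>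
      \<le> \<bar>z - of_int n\<bar> + \<bar>of_int j * (of_int q * a - of_int p)\<bar>" by simp
  also have "\<bar>of_int j * (of_int q * a - of_int p)\<bar> \<le> of_int q * (1 / N)"
    unfolding abs_mult using j assms(4) by (intro mult_mono) auto
  also have "\<bar>z - of_int n\<bar> \<le> 1/2" by (rule zn)
  finally have "of_int q * \<bar>real k * a - y - of_int m\<bar> \<le> 1/2 + of_int q * (1 / N)"
    using q by (simp add: abs_mult)
  then have "\<bar>real k * a - y - of_int m\<bar> \<le> (1/2 + of_int q * (1 / N)) / of_int q"
    using q by (simp add: pos_le_divide_eq mult.commute)
  also have "\<dots> = 1 / (2 * of_int q) + 1 / N" using q by (simp add: add_divide_distrib)
  finally show ?thesis using k by blast
qed

section \<open>Discarding rational approximations with small denominator\<close>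

lemma fmeasurable_ball_real: "ball (x::real) r \<in> fmeasurable lborel"
  using emeasure_lborel_ball_finite[of x r] by (auto intro!: fmeasurableI simp: less_top)

lemma measure_ball_real: "0 \<le> r \<Longrightarrow> measure lborel (ball (x::real) r) = 2 * r"
  by (simp add: ball_eq_greaterThanLessThan)

text \<open>The exceptional set: it catches the points of the unit interval with a Dirichlet
  approximation of order \<open>N\<close> whose denominator is at most \<open>e * N\<close>. For
  such points the numerator lies in \<open>0..q\<close>.\<close>

definition small_denominator_set :: "nat \<Rightarrow> real \<Rightarrow> real set" where
  "small_denominator_set N e = (\<Union>q\<in>{1..nat \<lfloor>e * N\<rfloor>}. \<Union>p\<in>{0..q}. ball (real p / q) (1 / (q * N)))"

lemma small_denominator_set_fmeasurable [intro]: "small_denominator_set N e \<in> fmeasurable lborel"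
  unfolding small_denominator_set_def
  by (intro fmeasurable.finite_UN) (auto simp: fmeasurable_ball_real)

text \<open>For each \<open>q\<close> there are at most \<open>2 * q\<close> balls of length
  \<open>2 / (q * N)\<close>, together at most \<open>4 / N\<close>; there are at most
  \<open>e * N\<close> values of \<open>q\<close>.\<close>

lemma measure_small_denominator_set:
  assumes "0 \<le> e" "0 < N"
  shows "measure lborel (small_denominator_set N e) \<le> 4 * e"
proof -
  have ball: "ball (real p / q) (1 / (q * N)) \<in> fmeasurable lborel" for p q
    by (rule fmeasurable_ball_real)
  have in1: "measure lborel (\<Union>p\<in>{0..q}. ball (real p / q) (1 / (q * N))) \<le> 4 / N" if "1 \<le> q" for q
  proof -
    have "measure lborel (\<Union>p\<in>{0..q}. ball (real p / q) (1 / (q * N)))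
        \<le> (\<Sum>p\<in>{0..q}. measure lborel (ball (real p / q) (1 / (q * N))))"
      using ball by (intro measure_UNION_le) (auto simp: fmeasurable_def)
    also have "\<dots> = (real q + 1) * (2 / (q * N))"
      by (simp add: measure_ball_real)
    also have "\<dots> \<le> (2 * real q) * (2 / (q * N))"
      using that by (intro mult_right_mono) auto
    also have "\<dots> = 4 / N" using that by simp
    finally show ?thesis .
  qed
  have "measure lborel (small_denominator_set N e) \<le>
     (\<Sum>q\<in>{1..nat \<lfloor>e * N\<rfloor>}. measure lborel (\<Union>p\<in>{0..q}. ball (real p / q) (1 / (q * N))))"
    unfolding small_denominator_set_def
    using ball by (intro measure_UNION_le fmeasurableD fmeasurable.finite_UN) auto
  also have "\<dots> \<le> (\<Sum>q\<in>{1..nat \<lfloor>e * N\<rfloor>}. 4 / N)" by (intro sum_mono in1) auto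
  also have "\<dots> = real (nat \<lfloor>e * N\<rfloor>) * (4 / N)" by simp
  also have "\<dots> \<le> (e * N) * (4 / N)" using assms by (intro mult_right_mono) auto
  also have "\<dots> = 4 * e" using assms by simp
  finally show ?thesis .
qed

text \<open>Dirichlet supplies a reduced \<open>p / q\<close> with \<open>q \<le> N\<close>, and
  avoiding the exceptional set forces \<open>q > e * N\<close>. The inhomogeneous error
  \<open>1 / (2 * q) + 1 / N\<close> is then of order \<open>1 / N\<close>, and division by
  \<open>k \<ge> N\<close> gains another factor \<open>1 / N\<close>.\<close>

lemma approximation_outside_small_denominator_set:
  fixes a y e :: real
  assumes "0 < a" "a < 1" "0 < N" "0 < e" "a \<notin> small_denominator_set N e"
  shows "\<exists>k\<in>{N..<2*N}. \<exists>m::int. \<bar>a - (y + of_int m) / k\<bar> \<le> (1 / (2 * e) + 1) / (real N)\<^sup>2"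
proof -
  obtain p q where pq: "coprime p q" "0 < q" "q \<le> int N" "\<bar>of_int q * a - of_int p\<bar> < 1 / N"
    using Dirichlet_approx_coprime[OF assms(3), of a] by metis
  have N: "real N \<ge> 1" using assms by simp
  have n1: "1 / real N \<le> 1" using N by simp
  have q: "(0::real) < of_int q" using pq by simp
  have qa: "0 < of_int q * a" "of_int q * a < of_int q" using assms q by auto
  then have "of_int p > (-1 :: real)" "of_int p < (of_int q + 1 :: real)" using pq(4) n1 by linarith+
  then have p: "0 \<le> p" "p \<le> q" by linarith+
  have "e * N < of_int q"
  proof (rule ccontr)
    assume "\<not> ?thesis"
    then have "of_int q \<le> e * N" by simp
    then have "q \<le> \<lfloor>e * N\<rfloor>" by (simp add: le_floor_iff)
    then have "nat q \<in> {1..nat \<lfloor>e * N\<rfloor>}" "nat p \<in> {0..nat q}" using pq p by auto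
    moreover have "a \<in> ball (real (nat p) / nat q) (1 / (nat q * N))"
    proof -
      have "\<bar>of_int p / of_int q - a\<bar> = \<bar>of_int q * a - of_int p\<bar> / of_int q"
        using q by (subst abs_minus_commute) (simp add: diff_divide_distrib abs_div_pos)
      also have "\<dots> < (1 / N) / of_int q" using pq q by (intro divide_strict_right_mono) auto
      finally show ?thesis using p pq(2) by (simp add: dist_real_def mult.commute)
    qed
    ultimately show False using assms(5) unfolding small_denominator_set_def by blast
  qed
  then have qe: "1 / (2 * of_int q) \<le> 1 / (2 * e * N)"
    using assms N q by (intro divide_left_mono) (auto intro!: mult_pos_pos)
  obtain k m where k: "k \<in> {N..<2*N}" and m: "\<bar>real k * a - y - of_int m\<bar> \<le> 1 / (2 * of_int q) + 1 / N"
    using exists_inhomogeneous_approximation[OF pq] by blast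
  have kp: "real k \<ge> N" "real k > 0" using k assms by auto
  have "a - (y + of_int m) / k = (real k * a - y - of_int m) / k"
    using kp by (simp add: field_simps)
  then have "\<bar>a - (y + of_int m) / k\<bar> = \<bar>real k * a - y - of_int m\<bar> / k" by simp
  also have "\<dots> \<le> (1 / (2 * e * N) + 1 / N) / k" using m qe kp by (intro divide_right_mono) auto
  also have "\<dots> \<le> (1 / (2 * e * N) + 1 / N) / N"
    using kp N assms by (intro divide_left_mono) auto
  also have "\<dots> = (1 / (2 * e) + 1) / (real N)\<^sup>2"
    using N by (simp add: power2_eq_square field_simps)
  finally show ?thesis using k by blast
qed

section \<open>Well-spaced families of approximants inside an open set\<close>

text \<open>Greedy choice: a new point is kept unless it is closer than \<open>d\<close> to one
  already kept. The alternative \<open>x = g\<close> covers the case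
  \<open>d \<le> 0\<close>.\<close>

lemma finite_maximal_separated_subset:
  fixes P :: "'a::metric_space set"
  assumes "finite P"
  shows "\<exists>G\<subseteq>P. (\<forall>x\<in>G. \<forall>y\<in>G. x \<noteq> y \<longrightarrow> d \<le> dist x y) \<and> (\<forall>x\<in>P. \<exists>g\<in>G. x = g \<or> dist x g < d)"
  using assms
proof (induction P rule: finite_induct)
  case empty
  then show ?case by auto
next
  case (insert p P)
  then obtain G where G: "G \<subseteq> P" "\<forall>x\<in>G. \<forall>y\<in>G. x \<noteq> y \<longrightarrow> d \<le> dist x y"
      "\<forall>x\<in>P. \<exists>g\<in>G. x = g \<or> dist x g < d" by blast
  show ?case
  proof (cases "\<exists>g\<in>G. dist p g < d")
    case True
    then show ?thesis using G by (intro exI[of _ G]) auto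
  next
    case False
    then show ?thesis using G
      by (intro exI[of _ "insert p G"]) (auto simp: dist_commute not_less)
  qed
qed

lemma finite_rational_translates: "finite {x::real. \<exists>k\<in>{N..<M}. \<exists>m::int. x = (y + of_int m) / real k \<and> \<bar>x\<bar> \<le> 1}"
  (is "finite ?X")
proof -
  have "m \<in> {- \<lceil>M + \<bar>y\<bar>\<rceil>..\<lceil>M + \<bar>y\<bar>\<rceil>} \<or> k = 0"
    if "k \<in> {N..<M}" "\<bar>(y + of_int m) / real k\<bar> \<le> 1" for k and m :: int
  proof (cases "k = 0")
    case False
    then have "\<bar>y + of_int m\<bar> \<le> real k" using that by (simp add: divide_simps)
    then have "\<bar>of_int m\<bar> \<le> real M + \<bar>y\<bar>" using that(1) by auto
    then show ?thesis by (simp add: abs_le_iff ceiling_le_iff le_ceiling_iff) linarith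
  qed auto
  \<comment> \<open>\<open>insert 0\<close> accounts for \<open>k = 0\<close>, where the quotient is
    0.\<close>
  then have "?X \<subseteq> insert 0 ((\<lambda>(k, m). (y + of_int m) / real k) ` ({N..<M} \<times> {- \<lceil>M + \<bar>y\<bar>\<rceil>..\<lceil>M + \<bar>y\<bar>\<rceil>}))"
    by fastforce
  then show ?thesis by (rule finite_subset) simp
qed

text \<open>The closed sets \<open>F n\<close> of points at distance at least
  \<open>1 / Suc n\<close> from the complement exhaust \<open>B\<close>, so continuity from below
  gives one \<open>n0\<close> that serves all small \<delta>.\<close>

lemma measure_inner_parallel_set_gt:
  fixes B :: "real set"
  assumes B: "open B" "B \<in> fmeasurable lborel" and c: "c < measure lborel B"
  shows "\<exists>n0. \<forall>\<delta>. 0 < \<delta> \<longrightarrow> \<delta> \<le> 1 / Suc n0 \<longrightarrow> 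
     (\<exists>D\<in>sets borel. D \<subseteq> {x. ball x \<delta> \<subseteq> B} \<and> c < measure lborel D)"
proof -
  define F where "F n = {x. \<forall>z. z \<notin> B \<longrightarrow> 1 / Suc n \<le> dist x z}" for n
  have cl: "closed (F n)" for n
    unfolding F_def by (intro closed_Collect_all closed_Collect_imp closed_Collect_le continuous_intros) auto
  have FB: "F n \<subseteq> B" for n by (auto simp: F_def)
  have inc: "incseq F"
    unfolding incseq_def F_def by (auto intro: order.trans[rotated] simp: frac_le)
  have un: "(\<Union>n. F n) = B"
  proof (intro equalityI subsetI)
    fix x assume "x \<in> B"
    then obtain e where e: "e > 0" "ball x e \<subseteq> B" using B(1) by (auto simp: open_contains_ball)
    obtain n where "1 / Suc n < e" using e(1) nat_approx_posE by blast
    then have "x \<in> F n" using e(2) by (force simp: F_def)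
    then show "x \<in> (\<Union>n. F n)" by blast
  qed (use FB in auto)
  have "(\<lambda>n. measure lborel (F n)) \<longlonglongrightarrow> measure lborel (\<Union>n. F n)"
    using cl inc B(2) by (intro Lim_measure_incseq) (auto simp: un fmeasurable_def)
  then have "\<forall>\<^sub>F n in sequentially. c < measure lborel (F n)"
    unfolding un using c by (rule order_tendstoD(1))
  then obtain n0 where n0: "c < measure lborel (F n0)" by (auto simp: eventually_sequentially)
  have "F n0 \<subseteq> {x. ball x \<delta> \<subseteq> B}" if "\<delta> \<le> 1 / Suc n0" for \<delta>
    using that by (force simp: F_def)
  then show ?thesis using n0 cl by (metis borel_closed)
qed

text \<open>Write \<delta> for \<open>C / 4^t\<close>. The part of \<open>B\<close> at depth
  \<open>2 * \<delta>\<close>, minus the exceptional set, is covered by balls of radius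
  \<open>3 * \<delta>\<close> about a maximal \<open>2 * \<delta>\<close>-separated set of
  approximants; comparing measures bounds their number from below.\<close>

lemma exists_separated_approximations:
  fixes B :: "real set" and y :: real
  assumes B: "open B" "B \<subseteq> {0<..<1}" and b: "0 < measure lborel B"
  obtains C T G where "0 < C"
    "\<forall>t\<ge>T. finite (G t)
     \<and> (\<forall>g\<in>G t. ball g (C / 4^t) \<subseteq> B \<and> (\<exists>k\<in>{2^t..<2^(t+1)}. \<exists>m::int. g = (y + of_int m) / real k))
     \<and> (\<forall>g\<in>G t. \<forall>h\<in>G t. g \<noteq> h \<longrightarrow> 2 * (C / 4^t) \<le> \<bar>g - h\<bar>)
     \<and> measure lborel B \<le> 12 * (C / 4^t) * card (G t)"
proof -
  define b where "b = measure lborel B"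
  \<comment> \<open>The exceptional set then has measure at most \<open>4 * e = b / 4\<close>. In
    \<open>C\<close> the summand 2 in place of 1 makes the approximation error strictly smaller than
    \<open>C / 4^t\<close>.\<close>
  define e where "e = b / 16"
  define C where "C = 1 / (2 * e) + 2"
  have b0: "0 < b" using b by (simp add: b_def)
  have e: "0 < e" using b0 by (simp add: e_def)
  have C: "0 < C" using e by (simp add: C_def add_pos_pos)
  have f01: "{0<..<1::real} \<in> fmeasurable lborel" by (simp add: fmeasurable_def)
  have fB: "B \<in> fmeasurable lborel" using B by (intro fmeasurableI2[OF f01]) auto
  obtain n0 where n0: "\<And>\<delta>. 0 < \<delta> \<Longrightarrow> \<delta> \<le> 1 / Suc n0 \<Longrightarrow>
      \<exists>D\<in>sets borel. D \<subseteq> {x. ball x \<delta> \<subseteq> B} \<and> 3/4 * b < measure lborel D"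
    using measure_inner_parallel_set_gt[OF B(1) fB, of "3/4 * b"] b0 unfolding b_def by auto
  have "(\<lambda>t. 2 * C * (1/4)^t) \<longlonglongrightarrow> 2 * C * 0"
    by (intro tendsto_intros LIMSEQ_power_zero) auto
  then have "\<forall>\<^sub>F t in sequentially. 2 * C * (1/4)^t < 1 / Suc n0"
    by (rule order_tendstoD(2)) auto
  then obtain T where T: "\<And>t. t \<ge> T \<Longrightarrow> 2 * C * (1/4)^t < 1 / Suc n0"
    by (auto simp: eventually_sequentially)
  have "\<exists>G. finite G
     \<and> (\<forall>g\<in>G. ball g (C / 4^t) \<subseteq> B \<and> (\<exists>k\<in>{2^t..<2^(t+1)}. \<exists>m::int. g = (y + of_int m) / real k))
     \<and> (\<forall>g\<in>G. \<forall>h\<in>G. g \<noteq> h \<longrightarrow> 2 * (C / 4^t) \<le> \<bar>g - h\<bar>)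
     \<and> b \<le> 12 * (C / 4^t) * card G" if t: "t \<ge> T" for t
  proof -
    define \<delta> where "\<delta> = C / 4^t"
    have \<delta>: "0 < \<delta>" using C by (simp add: \<delta>_def)
    \<comment> \<open>Depth \<open>2 * \<delta>\<close> ensures that an approximant within \<delta>
      of a point of \<open>D\<close> still has its own \<delta>-ball inside
      \<open>B\<close>.\<close>
    have "2 * \<delta> \<le> 1 / Suc n0" using T[OF t] by (simp add: \<delta>_def power_divide)
    then obtain D where D: "D \<in> sets borel" "\<And>x. x \<in> D \<Longrightarrow> ball x (2 * \<delta>) \<subseteq> B" "3/4 * b < measure lborel D"
      using n0[of "2 * \<delta>"] \<delta> by auto
    define P where "P = {x. (\<exists>k\<in>{2^t..<2^(t+1)}. \<exists>m::int. x = (y + of_int m) / real k) \<and> ball x \<delta> \<subseteq> B}"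
    have "P \<subseteq> {x. \<exists>k\<in>{2^t..<2^(t+1)}. \<exists>m::int. x = (y + of_int m) / real k \<and> \<bar>x\<bar> \<le> 1}"
    proof
      fix x assume x: "x \<in> P"
      then have "x \<in> B" using \<delta> unfolding P_def by (metis (no_types, lifting) centre_in_ball mem_Collect_eq subsetD)
      then have "\<bar>x\<bar> \<le> 1" using B by auto
      then show "x \<in> {x. \<exists>k\<in>{2^t..<2^(t+1)}. \<exists>m::int. x = (y + of_int m) / real k \<and> \<bar>x\<bar> \<le> 1}"
        using x unfolding P_def by blast
    qed
    then have fP: "finite P" by (rule finite_subset[OF _ finite_rational_translates])
    obtain G where G: "G \<subseteq> P" "\<And>g h. g \<in> G \<Longrightarrow> h \<in> G \<Longrightarrow> g \<noteq> h \<Longrightarrow> 2 * \<delta> \<le> dist g h"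
        "\<And>x. x \<in> P \<Longrightarrow> \<exists>g\<in>G. x = g \<or> dist x g < 2 * \<delta>"
      using finite_maximal_separated_subset[OF fP, of "2 * \<delta>"] by metis
    have fG: "finite G" using G(1) fP by (rule finite_subset)
    define S where "S = small_denominator_set (2^t) e"
    have cover: "D \<subseteq> S \<union> (\<Union>g\<in>G. ball g (3 * \<delta>))"
    proof
      fix a assume a: "a \<in> D"
      show "a \<in> S \<union> (\<Union>g\<in>G. ball g (3 * \<delta>))"
      proof (cases "a \<in> S")
        case False
        have "a \<in> B" using D(2)[OF a] \<delta> by (metis centre_in_ball mult_pos_pos subsetD zero_less_numeral)
        then have "0 < a" "a < 1" using B by auto
        then obtain k m where k: "k \<in> {2^t..<2*2^t}"
          and m: "\<bar>a - (y + of_int m) / real k\<bar> \<le> (1 / (2 * e) + 1) / (real (2^t))\<^sup>2"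
          using approximation_outside_small_denominator_set[of a "2^t" e y] False e
          unfolding S_def by auto
        define x where "x = (y + of_int m) / real k"
        have "(real (2^t))\<^sup>2 = 4^t" by (simp add: power2_eq_square flip: power_mult_distrib)
        then have "\<bar>a - x\<bar> \<le> (1 / (2 * e) + 1) / 4^t" using m by (simp add: x_def)
        also have "\<dots> < \<delta>" unfolding \<delta>_def C_def by (intro divide_strict_right_mono) auto
        finally have ax: "\<bar>a - x\<bar> < \<delta>" .
        have "ball x \<delta> \<subseteq> ball a (2 * \<delta>)"
          using ax by (auto simp: dist_real_def)
        then have "x \<in> P" using D(2)[OF a] k unfolding P_def x_def by auto
        then obtain g where g: "g \<in> G" "x = g \<or> dist x g < 2 * \<delta>" using G(3) by blast
        then have "a \<in> ball g (3 * \<delta>)" using ax \<delta> by (auto simp: dist_real_def)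
        then show ?thesis using g by blast
      qed auto
    qed
    have fS: "S \<in> fmeasurable lborel" unfolding S_def by (rule small_denominator_set_fmeasurable)
    have fU: "(\<Union>g\<in>G. ball g (3 * \<delta>)) \<in> fmeasurable lborel"
      using fG by (intro fmeasurable.finite_UN) (auto simp: fmeasurable_ball_real)
    \<comment> \<open>Of the measure \<open>3/4 * b\<close> at most \<open>b / 4\<close> is
      exceptional, so \<open>b / 2 \<le> 6 * \<delta> * card G\<close>.\<close>
    have "3/4 * b \<le> measure lborel D" using D by simp
    also have "\<dots> \<le> measure lborel (S \<union> (\<Union>g\<in>G. ball g (3 * \<delta>)))"
      using cover D fS fU by (intro measure_mono_fmeasurable fmeasurable.Un) auto
    also have "\<dots> \<le> measure lborel S + measure lborel (\<Union>g\<in>G. ball g (3 * \<delta>))"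
      using fS fU by (intro measure_Un_le) auto
    also have "measure lborel S \<le> 4 * e"
      unfolding S_def using e by (intro measure_small_denominator_set) auto
    also have "measure lborel (\<Union>g\<in>G. ball g (3 * \<delta>)) \<le> (\<Sum>g\<in>G. measure lborel (ball g (3 * \<delta>)))"
      using fG by (intro measure_UNION_le) auto
    also have "\<dots> = 6 * \<delta> * card G" using \<delta> by (simp add: measure_ball_real)
    finally have "b \<le> 12 * \<delta> * card G" by (simp add: e_def)
    then show ?thesis
      using fG G(1,2) unfolding P_def \<delta>_def dist_real_def by (intro exI[of _ G]) blast
  qed
  then have "\<forall>t. T \<le> t \<longrightarrow> (\<exists>G. finite G
     \<and> (\<forall>g\<in>G. ball g (C / 4^t) \<subseteq> B \<and> (\<exists>k\<in>{2^t..<2^(t+1)}. \<exists>m::int. g = (y + of_int m) / real k))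
     \<and> (\<forall>g\<in>G. \<forall>h\<in>G. g \<noteq> h \<longrightarrow> 2 * (C / 4^t) \<le> \<bar>g - h\<bar>)
     \<and> b \<le> 12 * (C / 4^t) * card G)" by (intro allI impI)
  then obtain G where "\<forall>t\<ge>T. finite (G t)
     \<and> (\<forall>g\<in>G t. ball g (C / 4^t) \<subseteq> B \<and> (\<exists>k\<in>{2^t..<2^(t+1)}. \<exists>m::int. g = (y + of_int m) / real k))
     \<and> (\<forall>g\<in>G t. \<forall>h\<in>G t. g \<noteq> h \<longrightarrow> 2 * (C / 4^t) \<le> \<bar>g - h\<bar>)
     \<and> b \<le> 12 * (C / 4^t) * card (G t)" unfolding choice_iff' by (elim exE)
  with C show thesis unfolding b_def by (rule that)
qed

section \<open>Quasi-independence\<close>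

lemma measure_UN_disjoint_balls:
  fixes G :: "real set"
  assumes "finite G" "0 \<le> \<rho>" "\<rho> \<le> \<delta>" "\<And>g h. g \<in> G \<Longrightarrow> h \<in> G \<Longrightarrow> g \<noteq> h \<Longrightarrow> 2 * \<delta> \<le> \<bar>g - h\<bar>"
  shows "measure lborel (\<Union>g\<in>G. ball g \<rho>) = 2 * \<rho> * card G"
proof -
  have "ball g \<rho> \<inter> ball h \<rho> = {}" if "g \<in> G" "h \<in> G" "g \<noteq> h" for g h
    using assms(4)[OF that] assms(3) by (auto simp: dist_real_def)
  then have "disjoint_family_on (\<lambda>g. ball g \<rho>) G" by (auto simp: disjoint_family_on_def)
  then have "measure lborel (\<Union>g\<in>G. ball g \<rho>) = (\<Sum>g\<in>G. measure lborel (ball g \<rho>))"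
    using assms(1) by (intro measure_finite_Union) (auto simp: emeasure_lborel_ball_finite[THEN less_imp_neq] fmeasurableD2[OF fmeasurable_ball_real])
  then show ?thesis using assms(2) by (simp add: measure_ball_real)
qed

text \<open>Packing: the \<delta>-balls about the points of \<open>G\<close> are disjoint and fit
  into \<open>S\<close>.\<close>

lemma card_separated_le:
  fixes G :: "real set"
  assumes "finite G" "0 < \<delta>" and sep: "\<And>g h. g \<in> G \<Longrightarrow> h \<in> G \<Longrightarrow> g \<noteq> h \<Longrightarrow> 2 * \<delta> \<le> \<bar>g - h\<bar>"
    and S: "S \<in> fmeasurable lborel" and sub: "\<And>g. g \<in> G \<Longrightarrow> ball g \<delta> \<subseteq> S"
  shows "2 * \<delta> * card G \<le> measure lborel S"
proof -
  have "2 * \<delta> * card G = measure lborel (\<Union>g\<in>G. ball g \<delta>)"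
    using assms by (intro measure_UN_disjoint_balls[symmetric]) auto
  also have "\<dots> \<le> measure lborel S" using sub assms(1) S by (intro measure_mono_fmeasurable) auto
  finally show ?thesis .
qed

text \<open>
  A ball of the coarser family meets at most \<open>\<rho> / \<delta>' + 2\<close> balls of the finer one, because the
  concentric balls of radius \<open>\<delta>'\<close> are disjoint.
\<close>

lemma measure_Int_UN_balls_le:
  fixes G H :: "real set"
  assumes G: "finite G" and H: "finite H" "\<And>g h. g \<in> H \<Longrightarrow> h \<in> H \<Longrightarrow> g \<noteq> h \<Longrightarrow> 2 * \<delta>' \<le> \<bar>g - h\<bar>"
    and \<rho>: "0 \<le> \<rho>" and \<rho>': "0 \<le> \<rho>'" "\<rho>' \<le> \<delta>'" and \<delta>': "0 < \<delta>'"
  shows "measure lborel ((\<Union>g\<in>G. ball g \<rho>) \<inter> (\<Union>h\<in>H. ball h \<rho>')) \<le> card G * (2 * \<rho>' * (\<rho> / \<delta>' + 2))"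
proof -
  have meas: "ball g \<rho> \<inter> (\<Union>h\<in>H. ball h \<rho>') \<in> sets lborel" for g
    by (simp add: open_Int open_UN borel_open)
  have one: "measure lborel (ball g \<rho> \<inter> (\<Union>h\<in>H. ball h \<rho>')) \<le> 2 * \<rho>' * (\<rho> / \<delta>' + 2)" for g
  proof -
    define K where "K = {h \<in> H. ball g \<rho> \<inter> ball h \<rho>' \<noteq> {}}"
    have fK: "finite K" using H by (simp add: K_def)
    \<comment> \<open>If the balls about \<open>g\<close> and \<open>h\<close> meet, then
      \<open>\<rho>' \<le> \<delta>'\<close> places the ball of radius \<open>\<delta>'\<close>
      about \<open>h\<close> inside the one of radius \<open>\<rho> + 2 * \<delta>'\<close> about
      \<open>g\<close>, so packing bounds \<open>card K\<close>.\<close>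
    have "2 * \<delta>' * card K \<le> measure lborel (ball g (\<rho> + 2 * \<delta>'))"
    proof (rule card_separated_le[OF fK \<delta>'])
      show "2 * \<delta>' \<le> \<bar>x - h\<bar>" if "x \<in> K" "h \<in> K" "x \<noteq> h" for x h
        using H(2) that by (auto simp: K_def)
      show "ball h \<delta>' \<subseteq> ball g (\<rho> + 2 * \<delta>')" if "h \<in> K" for h
        using that \<rho>' by (auto simp: K_def dist_real_def)
    qed (rule fmeasurable_ball_real)
    also have "\<dots> = 2 * (\<rho> + 2 * \<delta>')" using \<rho> \<delta>' by (intro measure_ball_real) auto
    finally have "2 * (card K * \<delta>') \<le> 2 * (\<rho> + 2 * \<delta>')" by (simp only: ac_simps)
    then have "card K \<le> (\<rho> + 2 * \<delta>') / \<delta>'" using \<delta>' by (simp add: pos_le_divide_eq)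
    also have "\<dots> = \<rho> / \<delta>' + 2" using \<delta>' by (simp add: field_simps)
    finally have cK: "card K \<le> \<rho> / \<delta>' + 2" .
    have "ball g \<rho> \<inter> (\<Union>h\<in>H. ball h \<rho>') \<subseteq> (\<Union>h\<in>K. ball h \<rho>')" by (auto simp: K_def)
    then have "measure lborel (ball g \<rho> \<inter> (\<Union>h\<in>H. ball h \<rho>')) \<le> measure lborel (\<Union>h\<in>K. ball h \<rho>')"
      using H fK by (intro measure_mono_fmeasurable fmeasurable.finite_UN meas) (auto simp: fmeasurable_ball_real)
    also have "\<dots> \<le> (\<Sum>h\<in>K. measure lborel (ball h \<rho>'))"
      using fK by (intro measure_UNION_le) auto
    also have "\<dots> = card K * (2 * \<rho>')" using \<rho>' by (simp add: measure_ball_real)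
    also have "\<dots> \<le> (\<rho> / \<delta>' + 2) * (2 * \<rho>')" using cK \<rho>' by (intro mult_right_mono) auto
    finally show ?thesis by (simp add: mult.commute)
  qed
  have "(\<Union>g\<in>G. ball g \<rho>) \<inter> (\<Union>h\<in>H. ball h \<rho>') = (\<Union>g\<in>G. ball g \<rho> \<inter> (\<Union>h\<in>H. ball h \<rho>'))" by auto
  then have "measure lborel ((\<Union>g\<in>G. ball g \<rho>) \<inter> (\<Union>h\<in>H. ball h \<rho>'))
      \<le> (\<Sum>g\<in>G. measure lborel (ball g \<rho> \<inter> (\<Union>h\<in>H. ball h \<rho>')))"
    using G meas by (simp only:) (rule measure_UNION_le)
  also have "\<dots> \<le> (\<Sum>g\<in>G. 2 * \<rho>' * (\<rho> / \<delta>' + 2))" by (intro sum_mono one)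
  finally show ?thesis by simp
qed

lemma sum_geometric_lower_le:
  "(\<Sum>s\<in>{K..<t}. (1/4::real)^(t - s)) \<le> 1/3"
proof (cases "K \<le> t")
  case True
  have "(\<Sum>s\<in>{K..<t}. (1/4::real)^(t - s)) = (1 - (1/4)^(t - K)) / 3"
    using True
  proof (induction t rule: dec_induct)
    case (step n)
    have "(\<Sum>s\<in>{K..<Suc n}. (1/4::real)^(Suc n - s)) = (\<Sum>s\<in>{K..<n}. (1/4::real)^(Suc n - s)) + 1/4"
      using step by simp
    also have "(\<Sum>s\<in>{K..<n}. (1/4::real)^(Suc n - s)) = (1/4) * (\<Sum>s\<in>{K..<n}. (1/4::real)^(n - s))"
      unfolding sum_distrib_left by (intro sum.cong) (auto simp: Suc_diff_le)
    finally show ?case using step by (simp add: Suc_diff_le field_simps)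
  qed simp
  also have "\<dots> \<le> 1/3" by simp
  finally show ?thesis .
qed simp

lemma sum_symmetric_pairs:
  fixes f :: "nat \<Rightarrow> nat \<Rightarrow> real"
  assumes "\<And>s t. f s t = f t s"
  shows "(\<Sum>s\<in>{K..<N}. \<Sum>t\<in>{K..<N}. f s t) = (\<Sum>t\<in>{K..<N}. f t t) + 2 * (\<Sum>t\<in>{K..<N}. \<Sum>s\<in>{K..<t}. f s t)"
proof (induction N)
  case (Suc N)
  show ?case
  proof (cases "K \<le> N")
    case True
    have "(\<Sum>s\<in>{K..<Suc N}. \<Sum>t\<in>{K..<Suc N}. f s t)
       = (\<Sum>s\<in>{K..<N}. \<Sum>t\<in>{K..<N}. f s t) + (\<Sum>s\<in>{K..<N}. f s N) + ((\<Sum>t\<in>{K..<N}. f N t) + f N N)"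
      using True by (simp add: sum.distrib)
    also have "(\<Sum>t\<in>{K..<N}. f N t) = (\<Sum>s\<in>{K..<N}. f s N)" by (intro sum.cong assms) simp
    finally show ?thesis using Suc True by simp
  qed simp
qed simp

text \<open>The geometric excess in \<open>pair\<close> sums to a multiple of the total weight
  \<open>W\<close>, which \<open>W \<ge> 1\<close> absorbs into its square. With first moment at
  least \<open>b * W / 6\<close> and second moment at most \<open>10/3 * b * W^2\<close>, the square
  of the former over the latter gives \<open>b / 120\<close>.\<close>

lemma measure_UN_quasi_independent_ge:
  fixes A :: "nat \<Rightarrow> 'a set" and b :: real and w :: "nat \<Rightarrow> real"
  assumes A: "\<And>t. K \<le> t \<Longrightarrow> A t \<in> fmeasurable M" and b: "0 \<le> b" and w: "\<And>t. 0 \<le> w t"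
    and lower: "\<And>t. K \<le> t \<Longrightarrow> b * w t / 6 \<le> measure M (A t)"
    and upper: "\<And>t. K \<le> t \<Longrightarrow> measure M (A t) \<le> b * w t"
    and pair: "\<And>s t. K \<le> s \<Longrightarrow> s < t \<Longrightarrow> measure M (A s \<inter> A t) \<le> b * (w s * w t + 2 * w t * (1/4)^(t - s))"
    and W: "1 \<le> (\<Sum>t\<in>{K..<N}. w t)"
  shows "b / 120 \<le> measure M (\<Union>t\<in>{K..<N}. A t)"
proof -
  define W where "W = (\<Sum>t\<in>{K..<N}. w t)"
  have W1: "1 \<le> W" using W by (simp add: W_def)
  have WW: "W\<^sup>2 = (\<Sum>t\<in>{K..<N}. w t * w t) + 2 * (\<Sum>t\<in>{K..<N}. \<Sum>s\<in>{K..<t}. w s * w t)"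
    unfolding W_def power2_eq_square sum_product by (rule sum_symmetric_pairs) simp
  have "(\<Sum>t\<in>{K..<N}. \<Sum>s\<in>{K..<t}. measure M (A s \<inter> A t))
      \<le> (\<Sum>t\<in>{K..<N}. \<Sum>s\<in>{K..<t}. b * (w s * w t + 2 * w t * (1/4)^(t - s)))"
    by (intro sum_mono pair) auto
  also have "\<dots> = b * (\<Sum>t\<in>{K..<N}. \<Sum>s\<in>{K..<t}. w s * w t) + b * (\<Sum>t\<in>{K..<N}. 2 * w t * (\<Sum>s\<in>{K..<t}. (1/4)^(t - s)))"
    by (simp add: sum_distrib_left sum.distrib distrib_left)
  also have "(\<Sum>t\<in>{K..<N}. 2 * w t * (\<Sum>s\<in>{K..<t}. (1/4)^(t - s))) \<le> (\<Sum>t\<in>{K..<N}. 2 * w t * (1/3))"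
    using w by (intro sum_mono mult_left_mono sum_geometric_lower_le) auto
  also have "(\<Sum>t\<in>{K..<N}. 2 * w t * (1/3)) = 2/3 * W"
    by (simp add: W_def sum_distrib_left)
  finally have off: "(\<Sum>t\<in>{K..<N}. \<Sum>s\<in>{K..<t}. measure M (A s \<inter> A t))
      \<le> b * (\<Sum>t\<in>{K..<N}. \<Sum>s\<in>{K..<t}. w s * w t) + b * (2/3 * W)"
    using b by (simp add: mult_left_mono)
  have diag: "(\<Sum>t\<in>{K..<N}. measure M (A t)) \<le> b * W"
    unfolding W_def sum_distrib_left by (intro sum_mono upper) auto
  have sq: "0 \<le> (\<Sum>t\<in>{K..<N}. w t * w t)" by (intro sum_nonneg) auto
  have "(\<Sum>s\<in>{K..<N}. \<Sum>t\<in>{K..<N}. measure M (A s \<inter> A t))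
      = (\<Sum>t\<in>{K..<N}. measure M (A t)) + 2 * (\<Sum>t\<in>{K..<N}. \<Sum>s\<in>{K..<t}. measure M (A s \<inter> A t))"
    by (subst sum_symmetric_pairs) (auto simp: Int_commute)
  also have "\<dots> \<le> b * W + 2 * (b * (\<Sum>t\<in>{K..<N}. \<Sum>s\<in>{K..<t}. w s * w t) + b * (2/3 * W))"
    using off diag by (intro add_mono mult_left_mono) auto
  \<comment> \<open>The factor \<open>7/3\<close> is 1 from the diagonal plus twice
    \<open>2/3\<close> from the geometric sums.\<close>
  also have "\<dots> = b * (W\<^sup>2 - (\<Sum>t\<in>{K..<N}. w t * w t)) + 7/3 * b * W"
    unfolding WW by (simp add: algebra_simps)
  also have "\<dots> \<le> b * W\<^sup>2 + 7/3 * b * W"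
    using mult_nonneg_nonneg[OF b sq] by (simp add: algebra_simps)
  also have "\<dots> \<le> 10/3 * b * W\<^sup>2"
  proof -
    have "W \<le> W\<^sup>2" using W1 by (simp add: power2_eq_square)
    then have "b * W \<le> b * W\<^sup>2" using b by (intro mult_left_mono) auto
    then show ?thesis by (simp add: mult.commute)
  qed
  finally have second: "(\<Sum>s\<in>{K..<N}. \<Sum>t\<in>{K..<N}. measure M (A s \<inter> A t)) \<le> 10/3 * b * W\<^sup>2" .
  have first: "b * W / 6 \<le> (\<Sum>t\<in>{K..<N}. measure M (A t))"
    unfolding W_def sum_distrib_left sum_divide_distrib by (intro sum_mono lower) auto
  \<comment> \<open>the maximiser of \<open>2 c (b W / 6) - c\<^sup>2 (10/3 b W\<^sup>2)\<close>\<close>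
  define c where "c = 1 / (20 * W)"
  have c0: "0 \<le> c" using W1 by (simp add: c_def)
  have cW: "c * W = 1/20" using W1 by (simp add: c_def)
  have "b / 120 = 2 * c * (b * W / 6) - c\<^sup>2 * (10/3 * b * W\<^sup>2)"
  proof -
    have "2 * c * (b * W / 6) - c\<^sup>2 * (10/3 * b * W\<^sup>2) = b * (c * W) / 3 - 10/3 * b * (c * W)\<^sup>2"
      by (simp add: power_mult_distrib algebra_simps)
    also have "\<dots> = b / 120" unfolding cW by (simp add: power2_eq_square)
    finally show ?thesis by simp
  qed
  also have "\<dots> \<le> 2 * c * (\<Sum>t\<in>{K..<N}. measure M (A t))
      - c\<^sup>2 * (\<Sum>s\<in>{K..<N}. \<Sum>t\<in>{K..<N}. measure M (A s \<inter> A t))"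
    using first second c0 by (intro diff_mono mult_left_mono) auto
  also have "\<dots> \<le> measure M (\<Union>t\<in>{K..<N}. A t)"
    using A by (intro measure_UN_ge_second_moment) auto
  finally show ?thesis .
qed

section \<open>The inhomogeneous Khintchine theorem\<close>

lemma open_inhomogeneously_approximable:
  fixes y :: real
  shows "open {a. \<exists>k\<ge>K. \<exists>m::int. \<bar>real k * a - y - of_int m\<bar> < r k}"
proof -
  have "open {a. \<bar>real k * a - y - of_int m\<bar> < r k}" for k and m :: int
    by (intro open_Collect_less continuous_intros)
  then have "open (\<Union>k\<in>{K..}. \<Union>m::int. {a. \<bar>real k * a - y - of_int m\<bar> < r k})" by blast
  also have "(\<Union>k\<in>{K..}. \<Union>m::int. {a. \<bar>real k * a - y - of_int m\<bar> < r k})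
    = {a. \<exists>k\<ge>K. \<exists>m::int. \<bar>real k * a - y - of_int m\<bar> < r k}" by auto
  finally show ?thesis .
qed

text \<open>For each \<open>B\<close>, finitely many scales of total weight at least 1 already fill
  \<open>1/120\<close> of \<open>B\<close>. The cutoff \<open>K\<close> is arbitrary, so
  intersecting over \<open>K\<close> yields infinitely many solutions almost everywhere.\<close>

lemma inhomogeneous_Khintchine_null:
  fixes r :: "nat \<Rightarrow> real" and y :: real
  assumes nonneg: "\<And>k. 0 \<le> r k" and mono: "\<And>k. 1 \<le> k \<Longrightarrow> r (Suc k) \<le> r k" and ns: "\<not> summable r"
  shows "emeasure lborel ({0<..<1} - {a. \<exists>k\<ge>K. \<exists>m::int. \<bar>real k * a - y - of_int m\<bar> < r k}) = 0"
proof -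
  define U where "U = {a. \<exists>k\<ge>K. \<exists>m::int. \<bar>real k * a - y - of_int m\<bar> < r k}"
  have oU: "open U"
    unfolding U_def by (rule open_inhomogeneously_approximable)
  have r_le: "r j \<le> r i" if "1 \<le> i" "i \<le> j" for i j
    using that(2)
  proof (induction rule: dec_induct)
    case (step n)
    then show ?case using mono[of n] that(1) by simp
  qed simp
  have "emeasure lborel ({0<..<1} - U) = 0"
  proof (rule measure_zero_if_thin_in_open_sets[where U = "{0<..<1}" and c = "1/120"])
    fix B :: "real set" assume B: "open B" "B \<subseteq> {0<..<1}" and b0: "0 < measure lborel B"
    define b where "b = measure lborel B"
    have "{0<..<1::real} \<in> fmeasurable lborel" by (simp add: fmeasurable_def)
    then have fB: "B \<in> fmeasurable lborel" by (rule fmeasurableI2) (use B in auto)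
    obtain C T G where C: "0 < C" and G0: "\<forall>t\<ge>T. finite (G t)
     \<and> (\<forall>g\<in>G t. ball g (C / 4^t) \<subseteq> B \<and> (\<exists>k\<in>{2^t..<2^(t+1)}. \<exists>m::int. g = (y + of_int m) / real k))
     \<and> (\<forall>g\<in>G t. \<forall>h\<in>G t. g \<noteq> h \<longrightarrow> 2 * (C / 4^t) \<le> \<bar>g - h\<bar>)
     \<and> measure lborel B \<le> 12 * (C / 4^t) * card (G t)"
      by (rule exists_separated_approximations[OF B b0, of y])
    have G: "\<And>t. T \<le> t \<Longrightarrow> finite (G t)"
      "\<And>t g. T \<le> t \<Longrightarrow> g \<in> G t \<Longrightarrow> ball g (C / 4^t) \<subseteq> B"
      "\<And>t g. T \<le> t \<Longrightarrow> g \<in> G t \<Longrightarrow> \<exists>k\<in>{2^t..<2^(t+1)}. \<exists>m::int. g = (y + of_int m) / real k"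
      "\<And>t g h. T \<le> t \<Longrightarrow> g \<in> G t \<Longrightarrow> h \<in> G t \<Longrightarrow> g \<noteq> h \<Longrightarrow> 2 * (C / 4^t) \<le> \<bar>g - h\<bar>"
      "\<And>t. T \<le> t \<Longrightarrow> b \<le> 12 * (C / 4^t) * card (G t)"
      using G0 unfolding b_def by (simp_all only:) blast
    define \<delta> where "\<delta> t = C / 4^t" for t
    \<comment> \<open>\<open>r (2^(t+1)) / 2^(t+1)\<close> is at most \<open>r k / k\<close> on the
      dyadic block of \<open>k\<close>, so every point of such a ball solves the inequality for the
      \<open>k\<close> of its centre. The minimum with \<open>\<delta> t\<close> keeps the balls
      disjoint.\<close>
    define \<rho> where "\<rho> t = min (\<delta> t) (r (2^(t+1)) / 2^(t+1))" for t
    define w where "w t = \<rho> t / \<delta> t" for t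
    define A where "A t = (\<Union>g\<in>G t. ball g (\<rho> t))" for t
    have \<delta>: "0 < \<delta> t" for t using C by (simp add: \<delta>_def)
    have \<rho>: "0 \<le> \<rho> t" "\<rho> t \<le> \<delta> t" for t
      using \<delta>[of t] nonneg[of "2^(t+1)"] by (auto simp: \<rho>_def min_def)
    have w0: "0 \<le> w t" for t using \<rho>(1)[of t] \<delta>[of t] by (simp add: w_def)
    \<comment> \<open>Since \<open>\<delta> t = 4 * C / 4^(t+1)\<close>, the weight is the term of
      Cauchy condensation up to a constant factor and truncation at 1.\<close>
    have weq: "w t = min 1 (2^(t+1) * r (2^(t+1)) / (4 * C))" for t
    proof -
      have "w t = min (\<delta> t / \<delta> t) (r (2^(t+1)) / 2^(t+1) / \<delta> t)"
        using \<delta>[of t] by (auto simp: w_def \<rho>_def min_def field_simps)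
      moreover have "r (2^(t+1)) / 2^(t+1) / \<delta> t = 2^(t+1) * r (2^(t+1)) / (4 * C)"
        using C by (simp add: \<delta>_def field_simps flip: power_mult_distrib)
      ultimately show ?thesis using \<delta>[of t] by simp
    qed
    have "\<not> summable (\<lambda>n. 2^n * r (2^n))"
      using condensation_test[of r] mono nonneg ns by auto
    then have "\<not> summable (\<lambda>t. 2^(t+1) * r (2^(t+1)))"
      using summable_Suc_iff[of "\<lambda>n. 2^n * r (2^n)"] by simp
    then have "\<not> summable (\<lambda>t. 2^(t+1) * r (2^(t+1)) / (4 * C))"
      unfolding summable_divide_iff using C by simp
    then have "\<not> summable w"
      unfolding weq[abs_def] using C nonneg by (intro not_summable_min) auto
    \<comment> \<open>From \<open>T\<close> on the families have their properties; from
      \<open>K\<close> on the denominators satisfy \<open>k \<ge> 2^t > t \<ge> K\<close>.\<close>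
    define L where "L = max T K"
    have LT: "T \<le> t" "K \<le> t" if "L \<le> t" for t using that by (auto simp: L_def)
    obtain N where N: "1 \<le> (\<Sum>t\<in>{L..<N}. w t)"
      using not_summable_sum_ge[OF w0 \<open>\<not> summable w\<close>] by blast
    have sep: "2 * \<delta> t \<le> \<bar>g - h\<bar>" if "L \<le> t" "g \<in> G t" "h \<in> G t" "g \<noteq> h" for t g h
      using G(4)[OF LT(1)] that by (simp add: \<delta>_def)
    have fA: "A t \<in> fmeasurable lborel" if "L \<le> t" for t
      unfolding A_def using G(1)[OF LT(1)] that
      by (intro fmeasurable.finite_UN) (auto simp: fmeasurable_ball_real)
    have mA: "measure lborel (A t) = 2 * \<rho> t * card (G t)" if "L \<le> t" for t
      unfolding A_def using G(1)[OF LT(1)] that \<rho> sep by (intro measure_UN_disjoint_balls[where \<delta> = "\<delta> t"]) auto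
    have cG: "2 * \<delta> t * card (G t) \<le> b" if "L \<le> t" for t
      unfolding b_def using G(1,2) LT that \<delta> sep fB
      by (intro card_separated_le) (auto simp: \<delta>_def)
    have \<rho>w: "\<rho> t = w t * \<delta> t" for t using \<delta>[of t] by (simp add: w_def)
    have "b / 120 \<le> measure lborel (\<Union>t\<in>{L..<N}. A t)"
    proof (rule measure_UN_quasi_independent_ge[where w = w])
      fix t assume t: "L \<le> t"
      have "b * w t \<le> 12 * \<delta> t * card (G t) * w t"
        using G(5)[OF LT(1)[OF t]] w0 unfolding \<delta>_def by (intro mult_right_mono) auto
      then show "b * w t / 6 \<le> measure lborel (A t)" unfolding mA[OF t] \<rho>w by (simp add: algebra_simps)
      have "(2 * \<delta> t * card (G t)) * w t \<le> b * w t" using cG[OF t] w0 by (intro mult_right_mono) auto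
      then show "measure lborel (A t) \<le> b * w t" unfolding mA[OF t] \<rho>w by (simp add: algebra_simps)
    next
      fix s t assume st: "L \<le> s" "s < t"
      then have t: "L \<le> t" by simp
      have q: "\<delta> t / \<delta> s = (1/4)^(t - s)"
        using C st by (simp add: \<delta>_def power_diff power_divide field_simps)
      have "measure lborel (A s \<inter> A t) \<le> card (G s) * (2 * \<rho> t * (\<rho> s / \<delta> t + 2))"
        unfolding A_def using G(1) LT st t \<rho> \<delta> sep by (intro measure_Int_UN_balls_le) auto
      \<comment> \<open>After substituting \<open>\<rho> = w * \<delta>\<close>, the factor
        \<open>2 * \<delta> s * card (G s)\<close> is the total length of disjoint balls in
        \<open>B\<close>, hence at most \<open>b\<close>.\<close>
      also have "\<dots> = (2 * \<delta> s * card (G s)) * (w s * w t + 2 * w t * (\<delta> t / \<delta> s))"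
        unfolding \<rho>w using \<delta>[of t] \<delta>[of s] by (simp add: field_simps)
      also have "\<dots> \<le> b * (w s * w t + 2 * w t * (\<delta> t / \<delta> s))"
        using cG[OF st(1)] w0 \<delta>[of t] \<delta>[of s] by (intro mult_right_mono add_nonneg_nonneg mult_nonneg_nonneg) auto
      finally show "measure lborel (A s \<inter> A t) \<le> b * (w s * w t + 2 * w t * (1/4)^(t - s))"
        unfolding q .
    qed (use fA w0 N b0 in \<open>auto simp: b_def\<close>)
    also have "\<dots> \<le> measure lborel (B - ({0<..<1} - U))"
    proof (rule measure_mono_fmeasurable)
      show "(\<Union>t\<in>{L..<N}. A t) \<subseteq> B - ({0<..<1} - U)"
      proof (rule UN_least)
        fix t assume "t \<in> {L..<N}"
        then have t: "L \<le> t" by simp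
        show "A t \<subseteq> B - ({0<..<1} - U)"
        proof
          fix a assume "a \<in> A t"
          then obtain g where g: "g \<in> G t" "a \<in> ball g (\<rho> t)" by (auto simp: A_def)
          have "a \<in> B" using G(2)[OF LT(1)[OF t] g(1)] g(2) \<rho>(2)[of t] by (auto simp: \<delta>_def)
          obtain k m where k: "k \<in> {2^t..<2^(t+1)}" and gm: "g = (y + of_int m) / real k"
            using G(3)[OF LT(1)[OF t] g(1)] by blast
          have k0: "0 < k" using k by (metis atLeastLessThan_iff less_le_trans zero_less_numeral zero_less_power)
          have kK: "K \<le> k"
          proof -
            have "K \<le> t" by (rule LT(2)[OF t])
            also have "t \<le> 2^t" by (rule less_imp_le[OF less_exp])
            also have "\<dots> \<le> k" using k by simp
            finally show ?thesis .
          qed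
          have kle: "real k \<le> 2^(t+1)" using k by (metis atLeastLessThan_iff less_imp_le of_nat_le_numeral_power_cancel_iff)
          \<comment> \<open>Since \<open>k * g - y\<close> is the integer \<open>m\<close>, the
            residual at \<open>a\<close> is \<open>k\<close> times the distance to the
            centre.\<close>
          have "\<bar>real k * a - y - of_int m\<bar> = real k * \<bar>g - a\<bar>"
          proof -
            have "real k * g = y + of_int m" using k0 by (simp add: gm)
            then have "real k * a - y - of_int m = - (real k * (g - a))" by (simp add: right_diff_distrib)
            then show ?thesis by (simp add: abs_mult)
          qed
          also have "\<dots> < real k * \<rho> t" using g k0 by (simp add: dist_real_def)
          also have "\<dots> \<le> real k * (r (2^(t+1)) / 2^(t+1))" by (intro mult_left_mono) (auto simp: \<rho>_def)
          also have "\<dots> \<le> 2^(t+1) * (r (2^(t+1)) / 2^(t+1))"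
            using kle nonneg by (intro mult_right_mono) auto
          also have "\<dots> = r (2^(t+1))" by simp
          also have "\<dots> \<le> r k" using k k0 by (intro r_le) auto
          finally have "a \<in> U" using kK unfolding U_def by blast
          with \<open>a \<in> B\<close> show "a \<in> B - ({0<..<1} - U)" by blast
        qed
      qed
      show "(\<Union>t\<in>{L..<N}. A t) \<in> sets lborel"
        by (rule sets.finite_UN) (use fA[THEN fmeasurableD] in auto)
      show "B - ({0<..<1} - U) \<in> fmeasurable lborel"
        using fB oU by (intro fmeasurable_Diff) auto
    qed
    finally show "1/120 * measure lborel B \<le> measure lborel (B - ({0<..<1} - U))" by (simp add: b_def)
  qed (use oU in auto)
  then show ?thesis by (simp add: U_def)
qed

section \<open>The circle\<close>

text \<open>Balls with rational centres and radii \<open>1 / Suc n\<close> form a base. Second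
  countability makes addition jointly measurable, as the Fubini argument below requires.\<close>

instance circle :: second_countable_topology
proof
  define \<B> where "\<B> = (\<lambda>(q, n). ball (circle_of q) (1 / real (Suc n))) ` (\<rat> \<times> (UNIV :: nat set))"
  have "countable \<B>" unfolding \<B>_def by (intro countable_image countable_SIGMA countable_rat) auto
  moreover have "topological_basis \<B>"
  proof (rule topological_basisI)
    show "open X" if "X \<in> \<B>" for X using that by (auto simp: \<B>_def)
  next
    fix O' and x :: circle assume O': "open O'" "x \<in> O'"
    then obtain e where e: "0 < e" "ball x e \<subseteq> O'" by (metis open_contains_ball)
    obtain u where u: "x = circle_of u" by (rule circle_of_surj)
    obtain n where n: "1 / real (Suc n) < e / 2" using e nat_approx_posE[of "e/2"] by auto
    obtain q where q: "q \<in> \<rat>" "u < q" "q < u + 1 / real (Suc n)"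
      using Rats_dense_in_real[of u "u + 1 / real (Suc n)"] by auto
    have d: "dist (circle_of q) x < 1 / real (Suc n)"
      using dist_circle_le[of q u] q by (simp add: u)
    have "ball (circle_of q) (1 / real (Suc n)) \<subseteq> ball x e"
    proof
      fix z assume "z \<in> ball (circle_of q) (1 / real (Suc n))"
      then have "dist (circle_of q) z < 1 / real (Suc n)" by simp
      moreover have "dist x z \<le> dist (circle_of q) x + dist (circle_of q) z" by (rule dist_triangle3)
      ultimately show "z \<in> ball x e" using n d by simp
    qed
    moreover have "ball (circle_of q) (1 / real (Suc n)) \<in> \<B>" using q by (auto simp: \<B>_def)
    ultimately show "\<exists>B'\<in>\<B>. x \<in> B' \<and> B' \<subseteq> O'" using d e by (intro bexI) auto
  qed
  ultimately show "\<exists>B::circle set set. countable B \<and> open = generate_topology B"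
    using topological_basis_imp_subbasis by blast
qed

section \<open>Haar measure as Lebesgue measure on a period\<close>

lemma emeasure_lborel_shift:
  fixes X :: "real set"
  assumes "X \<in> sets borel"
  shows "emeasure lborel ((+) c -` X) = emeasure lborel X"
  using emeasure_distr[of "(+) c" lborel borel X] assms by (simp add: lborel_distr_plus)

text \<open>The window is cut at the integer \<open>n + 1\<close> with \<open>n\<close> the floor of
  \<open>c\<close>; shifting the two pieces back by \<open>n\<close> and \<open>n + 1\<close>
  reassembles the unit interval.\<close>

lemma emeasure_periodic_unit_interval:
  fixes P :: "real set"
  assumes P: "P \<in> sets borel" and per: "\<And>x (n::int). x + of_int n \<in> P \<longleftrightarrow> x \<in> P"
  shows "emeasure lborel (P \<inter> {c..<c+1}) = emeasure lborel (P \<inter> {0..<1})"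
proof -
  define n where "n = \<lfloor>c\<rfloor>"
  have n: "of_int n \<le> c" "c < of_int n + 1" by (auto simp: n_def)
  have per': "of_int i + x \<in> P \<longleftrightarrow> x \<in> P" for i x using per[of x i] by (simp only: add.commute)
  have 1: "(+) (of_int n) -` (P \<inter> {c..<of_int n + 1}) = P \<inter> {c - of_int n..<1}"
    by (auto simp: per')
  define m where "m = n + 1"
  have m: "of_int m = of_int n + (1::real)" by (simp add: m_def)
  have 2: "(+) (of_int m) -` (P \<inter> {of_int n + 1..<c + 1}) = P \<inter> {0..<c - of_int n}"
    by (auto simp: per') (use m in linarith)+
  have "emeasure lborel (P \<inter> {c..<c+1}) = emeasure lborel ((P \<inter> {c..<of_int n + 1}) \<union> (P \<inter> {of_int n + 1..<c + 1}))"
    using n by (intro arg_cong[where f = "emeasure lborel"]) auto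
  also have "\<dots> = emeasure lborel (P \<inter> {c..<of_int n + 1}) + emeasure lborel (P \<inter> {of_int n + 1..<c + 1})"
    using P by (intro plus_emeasure[symmetric]) auto
  also have "\<dots> = emeasure lborel (P \<inter> {c - of_int n..<1}) + emeasure lborel (P \<inter> {0..<c - of_int n})"
    unfolding 1[symmetric] 2[symmetric] using P by (simp only: emeasure_lborel_shift sets.Int borel_closed atLeastLessThan_borel)
  also have "\<dots> = emeasure lborel ((P \<inter> {c - of_int n..<1}) \<union> (P \<inter> {0..<c - of_int n}))"
    using P by (intro plus_emeasure) auto
  also have "(P \<inter> {c - of_int n..<1}) \<union> (P \<inter> {0..<c - of_int n}) = P \<inter> {0..<1}" using n by auto
  finally show ?thesis .
qed

lemma circle_translate_image_eq_vimage: "(+) a ` A = (+) (- a :: circle) -` A"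
proof (intro set_eqI iffI)
  show "x \<in> (+) a ` A" if "x \<in> (+) (- a) -` A" for x
    using that by (intro image_eqI[of _ _ "- a + x"]) simp_all
qed auto

lemma circle_translate_borel: "A \<in> sets borel \<Longrightarrow> (+) (a::circle) ` A \<in> sets borel"
proof -
  assume A: "A \<in> sets borel"
  have "(+) (- a) \<in> borel_measurable borel"
    by (intro borel_measurable_continuous_onI continuous_intros)
  from measurable_sets[OF this A] show ?thesis by (simp add: circle_translate_image_eq_vimage)
qed

text \<open>Uniqueness of Haar measure: average the translates of \<open>A\<close> over a fundamental domain and apply Fubini.\<close>

lemma haar_prob_measure_emeasure:
  assumes \<mu>: "haar_prob_measure \<mu>" and A: "A \<in> sets borel"
  shows "emeasure \<mu> A = emeasure lborel (circle_of -` A \<inter> {c..<c+1})"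
proof -
  interpret prob_space \<mu> using \<mu> by (simp add: haar_prob_measure_def)
  interpret pair_sigma_finite \<mu> lborel ..
  have [measurable_cong]: "sets \<mu> = sets borel" using \<mu> by (simp add: haar_prob_measure_def)
  have sp: "space \<mu> = UNIV" using sets_eq_imp_space_eq[OF \<open>sets \<mu> = sets borel\<close>] by simp
  note [measurable] = A
  have inv: "emeasure \<mu> ((+) a ` A) = emeasure \<mu> A" for a
    using \<mu> A by (simp add: haar_prob_measure_def)
  define P where "P = circle_of -` A"
  have P: "P \<in> sets borel" unfolding P_def using measurable_sets[OF measurable_circle_of A] by simp
  have per: "x + of_int n \<in> P \<longleftrightarrow> x \<in> P" for x and n :: int
  proof -
    have "circle_of (x + of_int n) = circle_of x" by (simp add: circle_of_eq_iff)
    then show ?thesis by (simp add: P_def)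
  qed
  \<comment> \<open>Integrating first in \<open>x\<close> gives the measure of \<open>A\<close> by
    invariance; integrating first in \<open>u\<close> gives Lebesgue measure over one
    period.\<close>
  let ?f = "\<lambda>x u. indicator A (x + circle_of u) * indicator {0..<1::real} u :: ennreal"
  have [measurable]: "(\<lambda>(x, u). ?f x u) \<in> borel_measurable (\<mu> \<Otimes>\<^sub>M lborel)"
    by measurable
  have "(\<integral>\<^sup>+u. \<integral>\<^sup>+x. ?f x u \<partial>\<mu> \<partial>lborel) = (\<integral>\<^sup>+u. emeasure \<mu> A * indicator {0..<1::real} u \<partial>lborel)"
  proof (intro nn_integral_cong)
    fix u :: real
    have "(\<lambda>x. indicator A (x + circle_of u) :: ennreal) = indicator ((+) (- circle_of u) ` A)"
      unfolding circle_translate_image_eq_vimage by (intro ext) (simp add: indicator_def add.commute)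
    moreover have "(+) (- circle_of u) ` A \<in> sets \<mu>"
      using circle_translate_borel[OF A] \<open>sets \<mu> = sets borel\<close> by (simp only:)
    ultimately have "(\<integral>\<^sup>+x. indicator A (x + circle_of u) \<partial>\<mu>) = emeasure \<mu> A"
      by (simp only: nn_integral_indicator inv)
    then show "(\<integral>\<^sup>+x. ?f x u \<partial>\<mu>) = emeasure \<mu> A * indicator {0..<1::real} u"
      by (subst nn_integral_multc) auto
  qed
  also have "\<dots> = emeasure \<mu> A" by (subst nn_integral_cmult) auto
  finally have 1: "(\<integral>\<^sup>+u. \<integral>\<^sup>+x. ?f x u \<partial>\<mu> \<partial>lborel) = emeasure \<mu> A" .
  have "(\<integral>\<^sup>+x. \<integral>\<^sup>+u. ?f x u \<partial>lborel \<partial>\<mu>) = (\<integral>\<^sup>+x. emeasure lborel (P \<inter> {0..<1}) \<partial>\<mu>)"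
  proof (intro nn_integral_cong)
    fix x
    obtain v where v: "x = circle_of v" by (rule circle_of_surj)
    have "?f x = indicator ((+) v -` (P \<inter> {v..<v+1}))"
      by (intro ext) (auto simp: indicator_def P_def v circle_of_add)
    moreover have "(+) v -` (P \<inter> {v..<v+1}) \<in> sets borel"
      using measurable_sets[of "(+) v" borel borel "P \<inter> {v..<v+1}"] P by simp
    ultimately have "(\<integral>\<^sup>+u. ?f x u \<partial>lborel) = emeasure lborel ((+) v -` (P \<inter> {v..<v+1}))" by simp
    also have "\<dots> = emeasure lborel (P \<inter> {v..<v+1})" using P by (intro emeasure_lborel_shift) auto
    also have "\<dots> = emeasure lborel (P \<inter> {0..<1})" by (rule emeasure_periodic_unit_interval[OF P per])
    finally show "(\<integral>\<^sup>+u. ?f x u \<partial>lborel) = emeasure lborel (P \<inter> {0..<1})" .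
  qed
  also have "\<dots> = emeasure lborel (P \<inter> {0..<1})" by (simp add: emeasure_space_1)
  \<comment> \<open>A free base point \<open>c\<close> allows a ball to be measured on a window
    centred at a lift of its centre.\<close>
  also have "\<dots> = emeasure lborel (P \<inter> {c..<c+1})" by (rule emeasure_periodic_unit_interval[OF P per, symmetric])
  finally show ?thesis using Fubini'[of ?f] 1 by (simp add: P_def)
qed

lemma haar_prob_measure_unique:
  assumes "haar_prob_measure \<mu>" "haar_prob_measure \<nu>"
  shows "\<mu> = \<nu>"
proof (rule measure_eqI)
  show sets: "sets \<mu> = sets \<nu>" using assms by (simp add: haar_prob_measure_def)
  fix A assume "A \<in> sets \<mu>"
  then have A: "A \<in> sets borel" using assms(1) by (simp add: haar_prob_measure_def)
  show "emeasure \<mu> A = emeasure \<nu> A"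
    unfolding haar_prob_measure_emeasure[OF assms(1) A, of 0] haar_prob_measure_emeasure[OF assms(2) A, of 0] ..
qed

section \<open>Multiplication maps and their shrinking targets\<close>

lemma continuous_on_circle_scale: "continuous_on UNIV (circle_scale k)"
proof (induction k)
  case (Suc k)
  have "circle_scale (Suc k) = (\<lambda>a. a + circle_scale k a)" by (simp add: circle_scale_simps fun_eq_iff)
  then show ?case using Suc by (auto intro!: continuous_intros)
next
  case 0
  have "circle_scale 0 = (\<lambda>_. 0)" by (simp add: circle_scale_simps fun_eq_iff)
  then show ?case by simp
qed

lemma measurable_circle_scale: "circle_scale k \<in> borel_measurable borel"
  by (intro borel_measurable_continuous_onI continuous_on_circle_scale)

lemma circle_scale_circle_of: "circle_scale k (circle_of x) = circle_of (real k * x)"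
  by (rule circle_scale.abs_eq)

lemma circle_scale_diff: "circle_scale k (a - b) = circle_scale k a - circle_scale k b"
  by transfer (simp add: algebra_simps)

lemma circle_scale_mult: "circle_scale (j * k) a = circle_scale j (circle_scale k a)"
  by transfer (simp add: algebra_simps)

text \<open>The circle is divisible: some \<open>d\<close> has \<open>k\<close>-fold multiple
  \<open>a\<close>, so the preimage of a translate by \<open>a\<close> is the translate by
  \<open>d\<close> of the preimage. Uniqueness of Haar measure then shows that the map preserves
  it.\<close>

lemma haar_prob_measure_distr_circle_scale:
  assumes \<mu>: "haar_prob_measure \<mu>" and k: "1 \<le> k"
  shows "haar_prob_measure (distr \<mu> borel (circle_scale k))"
proof -
  interpret prob_space \<mu> using \<mu> by (simp add: haar_prob_measure_def)
  have sets: "sets \<mu> = sets borel" using \<mu> by (simp add: haar_prob_measure_def)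
  have sp: "space \<mu> = UNIV" using sets_eq_imp_space_eq[OF sets] by simp
  have T: "circle_scale k \<in> measurable \<mu> borel"
    using measurable_circle_scale measurable_cong_sets[OF sets refl] by blast
  have em: "emeasure (distr \<mu> borel (circle_scale k)) A = emeasure \<mu> (circle_scale k -` A)" if "A \<in> sets borel" for A
    using emeasure_distr[OF T that] by (simp add: sp)
  have "emeasure \<mu> (circle_scale k -` ((+) a ` A)) = emeasure \<mu> (circle_scale k -` A)"
    if A: "A \<in> sets borel" for a A
  proof -
    obtain u where u: "a = circle_of u" by (rule circle_of_surj)
    define d where "d = circle_of (u / real k)"
    have d: "circle_scale k d = a" using k by (simp add: d_def u circle_scale_circle_of)
    have "circle_scale k -` ((+) a ` A) = (+) d ` (circle_scale k -` A)"
      unfolding circle_translate_image_eq_vimage using circle_scale_diff[of k _ d]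
      by (auto simp: d add.commute)
    moreover have "circle_scale k -` A \<in> sets borel"
      using measurable_sets[OF measurable_circle_scale A] by simp
    ultimately show ?thesis using \<mu> by (simp add: haar_prob_measure_def)
  qed
  then show ?thesis
    using prob_space_distr[OF T] em circle_translate_borel unfolding haar_prob_measure_def by simp
qed

text \<open>In the window of length one centred at the lift \<open>y\<close>, every point is a
  nearest representative of its class. The bound turns divergence of the ball measures into
  divergence of the radii.\<close>

lemma haar_prob_measure_ball_le:
  assumes \<mu>: "haar_prob_measure \<mu>" and \<rho>: "0 \<le> \<rho>"
  shows "emeasure \<mu> (ball x \<rho>) \<le> ennreal (2 * \<rho>)"
proof -
  obtain y where y: "x = circle_of y" by (rule circle_of_surj)
  have "circle_of -` ball x \<rho> \<inter> {y - 1/2..<y - 1/2 + 1} \<subseteq> {y - \<rho>..y + \<rho>}"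
  proof
    fix a assume a: "a \<in> circle_of -` ball x \<rho> \<inter> {y - 1/2..<y - 1/2 + 1}"
    obtain n :: int where "dist (circle_of y) (circle_of a) = \<bar>y - a - of_int n\<bar>"
      by (rule dist_circle_attained)
    then have n: "\<bar>y - a - of_int n\<bar> < \<rho>" using a by (simp add: y)
    \<comment> \<open>Here \<open>a\<close> is within \<open>1/2\<close> of \<open>y\<close>, so a
      nonzero integer shift cannot bring it closer.\<close>
    have "\<bar>y - a\<bar> \<le> \<bar>y - a - of_int n\<bar>"
    proof (cases "n = 0")
      case False
      then have "1 \<le> \<bar>real_of_int n\<bar>" by linarith
      moreover have "y - 1/2 \<le> a" "a < y - 1/2 + 1" using a by auto
      ultimately show ?thesis by linarith
    qed simp
    then show "a \<in> {y - \<rho>..y + \<rho>}" using n by auto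
  qed
  then have "emeasure lborel (circle_of -` ball x \<rho> \<inter> {y - 1/2..<y - 1/2 + 1}) \<le> emeasure lborel {y - \<rho>..y + \<rho>}"
    by (intro emeasure_mono) auto
  also have "\<dots> = ennreal (2 * \<rho>)" using \<rho> by simp
  finally show ?thesis
    using haar_prob_measure_emeasure[OF \<mu>, of "ball x \<rho>" "y - 1/2"] by simp
qed

lemma fmp_system_circle_scale:
  assumes \<mu>: "haar_prob_measure \<mu>"
  shows "fmp_system \<mu> circle_scale"
proof -
  interpret prob_space \<mu> using \<mu> by (simp add: haar_prob_measure_def)
  have sets: "sets \<mu> = sets borel" using \<mu> by (simp add: haar_prob_measure_def)
  have sp: "space \<mu> = UNIV" using sets_eq_imp_space_eq[OF sets] by simp
  have T: "circle_scale k \<in> measurable \<mu> borel" for k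
    using measurable_circle_scale measurable_cong_sets[OF sets refl] by blast
  have "emeasure \<mu> (circle_scale k -` A) = emeasure \<mu> A" if "1 \<le> k" "A \<in> sets borel" for k A
  proof -
    have "distr \<mu> borel (circle_scale k) = \<mu>"
      using haar_prob_measure_unique haar_prob_measure_distr_circle_scale \<mu> that(1) by blast
    then show ?thesis using emeasure_distr[OF T that(2), of k] by (simp add: sp)
  qed
  moreover have "circle_scale k \<in> measurable \<mu> \<mu>" for k
    using measurable_circle_scale measurable_cong_sets[OF sets sets] by blast
  ultimately show ?thesis
    unfolding fmp_system_def using sets finite_measure_axioms
    by (auto simp: circle_scale_mult fun_eq_iff)
qed

lemma MSTP_circle_scale:
  assumes \<mu>: "haar_prob_measure \<mu>"
  shows "MSTP \<mu> circle_scale"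
  unfolding MSTP_def
proof (intro allI impI, elim conjE)
  fix x :: circle and r :: "nat \<Rightarrow> real"
  assume r0: "\<forall>k\<ge>1. 0 \<le> r k" and rmono: "\<forall>k\<ge>1. r (k + 1) \<le> r k"
    and div: "(\<Sum>k. emeasure \<mu> (ball x (r (k + 1)))) = \<infinity>"
  have sets: "sets \<mu> = sets borel" using \<mu> by (simp add: haar_prob_measure_def)
  have sp: "space \<mu> = UNIV" using sets_eq_imp_space_eq[OF sets] by simp
  obtain y where y: "x = circle_of y" by (rule circle_of_surj)
  \<comment> \<open>The hypotheses leave \<open>r 0\<close> free. Setting it to 0 makes the sequence
    nonnegative everywhere and excludes \<open>k = 0\<close> from the strict inequality.\<close>
  define r' where "r' k = (if k = 0 then 0 else r k)" for k
  have ns: "\<not> summable r'"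
  proof
    assume "summable r'"
    then have "summable (\<lambda>k. r' (Suc k))" by (rule summable_Suc_iff[THEN iffD2])
    then have s: "summable (\<lambda>k. 2 * r (k + 1))" by (intro summable_mult) (simp add: r'_def)
    have "(\<Sum>k. emeasure \<mu> (ball x (r (k + 1)))) \<le> (\<Sum>k. ennreal (2 * r (k + 1)))"
      using r0 by (intro suminf_le haar_prob_measure_ball_le[OF \<mu>]) auto
    also have "\<dots> = ennreal (\<Sum>k. 2 * r (k + 1))"
      using r0 s by (intro suminf_ennreal2) auto
    finally show False using div by (simp add: top_unique)
  qed
  have r'0: "0 \<le> r' k" for k using r0 by (simp add: r'_def)
  have r'mono: "r' (Suc k) \<le> r' k" if "1 \<le> k" for k using rmono that by (simp add: r'_def)
  define V where "V K = {a. \<exists>k\<ge>K. \<exists>m::int. \<bar>real k * a - y - of_int m\<bar> < r' k}" for K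
  have null: "emeasure lborel ({0<..<1} - V K) = 0" for K
    unfolding V_def by (rule inhomogeneous_Khintchine_null[OF r'0 r'mono ns])
  have oV: "open (V K)" for K
    unfolding V_def by (rule open_inhomogeneously_approximable)
  define X where "X k = circle_scale k -` ball x (r k)" for k
  define S where "S = {z. infinite {k. 1 \<le> k \<and> z \<in> X k}}"
  have Seq: "S = (\<Inter>n. \<Union>k\<in>{n<..}. X k)"
  proof (intro set_eqI)
    fix z
    have "z \<in> S \<longleftrightarrow> (\<forall>n. \<exists>k>n. 1 \<le> k \<and> z \<in> X k)"
      unfolding S_def infinite_nat_iff_unbounded by (simp only: mem_Collect_eq)
    also have "\<dots> \<longleftrightarrow> (\<forall>n. \<exists>k>n. z \<in> X k)" by (intro all_cong1 ex_cong1) auto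
    finally show "z \<in> S \<longleftrightarrow> z \<in> (\<Inter>n. \<Union>k\<in>{n<..}. X k)" by auto
  qed
  have "X k \<in> sets borel" for k
    unfolding X_def using measurable_sets[OF measurable_circle_scale, of "ball x (r k)"] by simp
  then have mS: "S \<in> sets borel" unfolding Seq by auto
  \<comment> \<open>A lift outside the limsup set misses some tail set \<open>V K\<close>; the point
    0 is added because the Khintchine statement concerns the open interval.\<close>
  have "circle_of -` (- S) \<inter> {0..<1} \<subseteq> {0} \<union> (\<Union>K. {0<..<1} - V K)"
  proof
    fix a assume a: "a \<in> circle_of -` (- S) \<inter> {0..<1}"
    then obtain n where n: "\<And>k. n < k \<Longrightarrow> circle_of a \<notin> X k"
      unfolding Seq by auto
    have "a \<notin> V (Suc n)"
    proof
      assume "a \<in> V (Suc n)"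
      then obtain k and m :: int where k: "Suc n \<le> k" and m: "\<bar>real k * a - y - of_int m\<bar> < r' k"
        by (auto simp: V_def)
      have "circle_of (y + of_int m) = x" by (simp add: y circle_of_eq_iff)
      then have "dist x (circle_scale k (circle_of a)) \<le> \<bar>(y + of_int m) - real k * a\<bar>"
        using dist_circle_le[of "y + of_int m" "real k * a"] by (simp add: circle_scale_circle_of)
      also have "\<dots> < r k" using m k by (simp add: r'_def split: if_splits)
      finally show False using n[of k] k by (simp add: X_def)
    qed
    then show "a \<in> {0} \<union> (\<Union>K. {0<..<1} - V K)" using a by (cases "a = 0") auto
  qed
  moreover have "{0} \<union> (\<Union>K. {0<..<1} - V K) \<in> null_sets lborel"
    using null oV by (intro null_sets.Un null_sets_UN) (auto simp: null_sets_def)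
  moreover have "circle_of -` (- S) \<inter> {0..<1} \<in> sets lborel"
    using measurable_sets[OF measurable_circle_of, of "- S"] mS by auto
  ultimately have "emeasure lborel (circle_of -` (- S) \<inter> {0..<1}) = 0"
    using null_sets_subset by (metis null_setsD1)
  then have "emeasure \<mu> (- S) = 0"
    using haar_prob_measure_emeasure[OF \<mu>, of "- S" 0] mS by auto
  then have "- S \<in> null_sets \<mu>" using mS sets by (auto simp: null_sets_def)
  then have "emeasure \<mu> (S \<union> - S) = emeasure \<mu> S" using mS sets by (intro emeasure_Un_null_set) auto
  then show "emeasure \<mu> {z. infinite {k. 1 \<le> k \<and> z \<in> circle_scale k -` ball x (r k)}} = emeasure \<mu> (space \<mu>)"
    by (simp add: S_def X_def sp Compl_partition)
qed

theorem theorem1p3: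
  fixes \<mu> :: "circle measure"
  assumes "haar_prob_measure \<mu>"
  shows "fmp_system \<mu> circle_scale \<and> MSTP \<mu> circle_scale"
  using fmp_system_circle_scale[OF assms] MSTP_circle_scale[OF assms] by blast

end
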